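(* Feedback Vertex Set by CVD and Odd Cycle Transversal by CVD, even when a chordal vertex deletion set (modulator) of size $k$ is given as input, cannot be solved in ${\mathcal O}^*((2- \epsilon)^{k})$ time for any $\epsilon >0$ assuming the Strong Exponential Time Hypothesis (SETH).
   Context: Feedback Vertex Set by CVD: given graph $G$ and integers $k,\ell$, with parameter $k$ the size of a chordal vertex deletion set (a vertex set whose deletion leaves a chordal graph), decide whether there is a set $X$ of at most $\ell$ vertices with $G-X$ a forest. Odd Cycle Transversal by CVD: same, but $G-X$ must be bipartite. ${\mathcal O}^*$ hides factors polynomial in the input size. *)

theory Defs
  imports Complex_Main "HOL-Computational_Algebra.Polynomial"
begin

section \<open>Model of computation\<close>

text \<open>
  The model is the language WHILE over binary trees (N. D. Jones, Computability and Complexity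
  from a Programming Perspective, 1997), with one time unit per operation. There is no deep
  equality test, so values can be shared and each operation takes a constant number of steps of a
  random access machine. Conversely, \<open>t\<close> steps of a random access machine with logarithmically
  sized words are simulated with overhead polynomial in \<open>log t\<close>, keeping the memory in a binary
  trie. For times \<open>t\<close> of the form \<open>c\<close> to the power \<open>k\<close> times a polynomial in the input size, this
  overhead is polynomial in \<open>k\<close> and the input size.
\<close>

datatype tree = Leaf | Node tree tree

primrec hd_tree :: "tree \<Rightarrow> tree" where
  "hd_tree Leaf = Leaf"
| "hd_tree (Node l r) = l"

primrec tl_tree :: "tree \<Rightarrow> tree" where
  "tl_tree Leaf = Leaf"
| "tl_tree (Node l r) = r"

datatype exp = Var nat | Nil_exp | Cons_exp exp exp | Hd_exp exp | Tl_exp exp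

type_synonym state = "nat \<Rightarrow> tree"

primrec eval_exp :: "exp \<Rightarrow> state \<Rightarrow> tree" where
  "eval_exp (Var x) s = s x"
| "eval_exp Nil_exp s = Leaf"
| "eval_exp (Cons_exp a b) s = Node (eval_exp a s) (eval_exp b s)"
| "eval_exp (Hd_exp a) s = hd_tree (eval_exp a s)"
| "eval_exp (Tl_exp a) s = tl_tree (eval_exp a s)"

primrec cost_exp :: "exp \<Rightarrow> nat" where
  "cost_exp (Var x) = 1"
| "cost_exp Nil_exp = 1"
| "cost_exp (Cons_exp a b) = cost_exp a + cost_exp b + 1"
| "cost_exp (Hd_exp a) = cost_exp a + 1"
| "cost_exp (Tl_exp a) = cost_exp a + 1"

datatype com = Assign nat exp | Seq com com | Cond exp com com | While exp com

text \<open>\<open>exec c s t s'\<close>: started in \<open>s\<close>, the program \<open>c\<close> halts after time \<open>t\<close> in state \<open>s'\<close>.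
  \<^const>\<open>Leaf\<close> is the truth value false, every other tree is true.\<close>

inductive exec :: "com \<Rightarrow> state \<Rightarrow> nat \<Rightarrow> state \<Rightarrow> bool" where
  Assign: "exec (Assign x e) s (cost_exp e + 1) (s(x := eval_exp e s))"
| Seq: "exec c1 s t1 s' \<Longrightarrow> exec c2 s' t2 s'' \<Longrightarrow> exec (Seq c1 c2) s (t1 + t2) s''"
| Cond_true: "eval_exp e s \<noteq> Leaf \<Longrightarrow> exec c1 s t s' \<Longrightarrow> exec (Cond e c1 c2) s (cost_exp e + 1 + t) s'"
| Cond_false: "eval_exp e s = Leaf \<Longrightarrow> exec c2 s t s' \<Longrightarrow> exec (Cond e c1 c2) s (cost_exp e + 1 + t) s'"
| While_false: "eval_exp e s = Leaf \<Longrightarrow> exec (While e c) s (cost_exp e + 1) s"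
| While_true: "eval_exp e s \<noteq> Leaf \<Longrightarrow> exec c s t1 s' \<Longrightarrow> exec (While e c) s' t2 s'' \<Longrightarrow>
    exec (While e c) s (cost_exp e + 1 + t1 + t2) s''"

text \<open>Input and output are passed in variable 0; all other variables start as \<^const>\<open>Leaf\<close>.\<close>

definition init_state :: "tree \<Rightarrow> state" where
  "init_state d = (\<lambda>x. if x = 0 then d else Leaf)"

definition decides_within :: "com \<Rightarrow> tree \<Rightarrow> bool \<Rightarrow> real \<Rightarrow> bool" where
  "decides_within c d answer bound \<longleftrightarrow>
     (\<exists>t s'. exec c (init_state d) t s' \<and> (s' 0 \<noteq> Leaf \<longleftrightarrow> answer) \<and> real t \<le> bound)"

section \<open>Parameterized problems and the O* notation\<close>

text \<open>A (promise) problem: an algorithm has to be correct and fast on \<open>instances\<close> only.\<close>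

record 'a param_problem =
  instances :: "'a set"
  yes_instance :: "'a \<Rightarrow> bool"
  encode :: "'a \<Rightarrow> tree"
  parameter :: "'a \<Rightarrow> nat"

text \<open>The input size is the number of \<^const>\<open>Node\<close> cells of the encoding.\<close>

definition solvable_in_Ostar :: "'a param_problem \<Rightarrow> (nat \<Rightarrow> real) \<Rightarrow> bool" where
  "solvable_in_Ostar P f \<longleftrightarrow>
     (\<exists>(c :: com) (p :: nat poly). \<forall>I \<in> instances P.
        decides_within c (encode P I) (yes_instance P I)
          (f (parameter P I) * real (poly p (size (encode P I)))))"

text \<open>Numbers are encoded in unary. All of them are vertices, variables, or counts of such, so
  this changes the input size polynomially only.\<close>

primrec enc_nat :: "nat \<Rightarrow> tree" where
  "enc_nat 0 = Leaf"
| "enc_nat (Suc n) = Node Leaf (enc_nat n)"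

definition enc_bool :: "bool \<Rightarrow> tree" where
  "enc_bool b = (if b then Node Leaf Leaf else Leaf)"

fun enc_pair :: "('a \<Rightarrow> tree) \<Rightarrow> ('b \<Rightarrow> tree) \<Rightarrow> 'a \<times> 'b \<Rightarrow> tree" where
  "enc_pair f g (x, y) = Node (f x) (g y)"

primrec enc_list :: "('a \<Rightarrow> tree) \<Rightarrow> 'a list \<Rightarrow> tree" where
  "enc_list f [] = Leaf"
| "enc_list f (x # xs) = Node (f x) (enc_list f xs)"

section \<open>The Strong Exponential Time Hypothesis\<close>

text \<open>\<open>(True, v)\<close> is the positive and \<open>(False, v)\<close> the negative literal of the variable \<open>v\<close>.
  A formula \<open>(n, F)\<close> has the variables \<open>0, \<dots>, n - 1\<close>.\<close>

type_synonym literal = "bool \<times> nat"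
type_synonym clause = "literal list"
type_synonym cnf = "nat \<times> clause list"

definition is_q_cnf :: "nat \<Rightarrow> cnf \<Rightarrow> bool" where
  "is_q_cnf q = (\<lambda>(n, F). \<forall>C \<in> set F. length C \<le> q \<and> (\<forall>(b, v) \<in> set C. v < n))"

definition satisfiable :: "cnf \<Rightarrow> bool" where
  "satisfiable = (\<lambda>(n, F). \<exists>\<sigma> :: nat \<Rightarrow> bool. \<forall>C \<in> set F. \<exists>(b, v) \<in> set C. \<sigma> v = b)"

definition q_SAT :: "nat \<Rightarrow> cnf param_problem" where
  "q_SAT q = \<lparr> instances = {\<phi>. is_q_cnf q \<phi>},
               yes_instance = satisfiable,
               encode = enc_pair enc_nat (enc_list (enc_list (enc_pair enc_bool enc_nat))),
               parameter = fst \<rparr>"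

definition sat_exponent :: "nat \<Rightarrow> real" where
  "sat_exponent q =
     Inf {\<delta>. \<delta> \<ge> 0 \<and> solvable_in_Ostar (q_SAT q) (\<lambda>n. 2 powr (\<delta> * real n))}"

definition SETH :: bool where
  "SETH \<longleftrightarrow> sat_exponent \<longlonglongrightarrow> 1"

section \<open>Graphs\<close>

text \<open>Simple undirected graphs as pairs of a vertex set and a set of two-element edges.\<close>

type_synonym 'a graph = "'a set \<times> 'a set set"

definition delete_vertices :: "'a graph \<Rightarrow> 'a set \<Rightarrow> 'a graph" where
  "delete_vertices G X = (fst G - X, {e \<in> snd G. e \<inter> X = {}})"

definition is_cycle :: "'a graph \<Rightarrow> 'a list \<Rightarrow> bool" where
  "is_cycle G vs \<longleftrightarrow> length vs \<ge> 3 \<and> distinct vs \<and> set vs \<subseteq> fst G \<and>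
     (\<forall>i < length vs. {vs ! i, vs ! (Suc i mod length vs)} \<in> snd G)"

definition forest :: "'a graph \<Rightarrow> bool" where
  "forest G \<longleftrightarrow> \<not> (\<exists>vs. is_cycle G vs)"

definition bipartite :: "'a graph \<Rightarrow> bool" where
  "bipartite G \<longleftrightarrow> (\<exists>A B. A \<union> B = fst G \<and> A \<inter> B = {} \<and>
     (\<forall>e \<in> snd G. \<exists>a \<in> A. \<exists>b \<in> B. e = {a, b}))"

definition has_chord :: "'a graph \<Rightarrow> 'a list \<Rightarrow> bool" where
  "has_chord G vs \<longleftrightarrow> (\<exists>i < length vs. \<exists>j < length vs.
     {vs ! i, vs ! j} \<in> snd G \<and> i \<noteq> j \<and>
     j \<noteq> Suc i mod length vs \<and> i \<noteq> Suc j mod length vs)"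

definition chordal :: "'a graph \<Rightarrow> bool" where
  "chordal G \<longleftrightarrow> (\<forall>vs. is_cycle G vs \<and> length vs \<ge> 4 \<longrightarrow> has_chord G vs)"

definition chordal_deletion_set :: "'a graph \<Rightarrow> 'a set \<Rightarrow> bool" where
  "chordal_deletion_set G S \<longleftrightarrow> S \<subseteq> fst G \<and> chordal (delete_vertices G S)"

section \<open>Vertex deletion problems parameterized by chordal vertex deletion\<close>

text \<open>An input graph \<open>(n, es)\<close> has the vertices \<open>0, \<dots>, n - 1\<close>; every edge is listed in at least
  one of its two orientations.\<close>

type_synonym graph_input = "nat \<times> (nat \<times> nat) list"

definition valid_graph_input :: "graph_input \<Rightarrow> bool" where
  "valid_graph_input = (\<lambda>(n, es). \<forall>(u, v) \<in> set es. u < n \<and> v < n \<and> u \<noteq> v)"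

definition graph_of :: "graph_input \<Rightarrow> nat graph" where
  "graph_of = (\<lambda>(n, es). ({..<n}, {{u, v} | u v. (u, v) \<in> set es}))"

definition enc_graph :: "graph_input \<Rightarrow> tree" where
  "enc_graph = enc_pair enc_nat (enc_list (enc_pair enc_nat enc_nat))"

definition has_deletion_set :: "('a graph \<Rightarrow> bool) \<Rightarrow> 'a graph \<Rightarrow> nat \<Rightarrow> bool" where
  "has_deletion_set \<Pi> G l \<longleftrightarrow>
     (\<exists>X \<subseteq> fst G. card X \<le> l \<and> \<Pi> (delete_vertices G X))"

text \<open>Instances \<open>(g, k, l)\<close>.\<close>

definition deletion_by_cvd ::
    "(nat graph \<Rightarrow> bool) \<Rightarrow> (graph_input \<times> nat \<times> nat) param_problem" where
  "deletion_by_cvd \<Pi> =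
     \<lparr> instances = {(g, k, l). valid_graph_input g \<and>
         (\<exists>S. chordal_deletion_set (graph_of g) S \<and> card S = k)},
       yes_instance = (\<lambda>(g, k, l). has_deletion_set \<Pi> (graph_of g) l),
       encode = enc_pair enc_graph (enc_pair enc_nat enc_nat),
       parameter = (\<lambda>(g, k, l). k) \<rparr>"

text \<open>Instances \<open>(S, g, k, l)\<close>: the modulator \<open>S\<close> is part of the input.\<close>

definition deletion_by_given_cvd ::
    "(nat graph \<Rightarrow> bool) \<Rightarrow> (nat list \<times> graph_input \<times> nat \<times> nat) param_problem" where
  "deletion_by_given_cvd \<Pi> =
     \<lparr> instances = {(S, g, k, l). valid_graph_input g \<and>
         chordal_deletion_set (graph_of g) (set S) \<and> distinct S \<and> length S = k},
       yes_instance = (\<lambda>(S, g, k, l). has_deletion_set \<Pi> (graph_of g) l),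
       encode = enc_pair (enc_list enc_nat) (enc_pair enc_graph (enc_pair enc_nat enc_nat)),
       parameter = (\<lambda>(S, g, k, l). k) \<rparr>"

definition "FVS_by_CVD = deletion_by_cvd forest"
definition "OCT_by_CVD = deletion_by_cvd bipartite"
definition "FVS_by_given_CVD = deletion_by_given_cvd forest"
definition "OCT_by_given_CVD = deletion_by_given_cvd bipartite"

end

theory Submission
  imports Defs
begin

text \<open>
  A \<open>q\<close>-CNF formula with \<open>n\<close> variables is turned into a graph whose chordal modulator has about
  \<open>n\<close> vertices. Deleting a modulator vertex can only help, so an assignment cannot be read off
  the deleted set directly. Instead, the variables are cut into blocks of \<open>p\<close>, and the
  \<open>2^p\<close> assignments of a block are represented by sets of \<open>m\<close> out of \<open>2m\<close> modulator vertices,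
  with \<open>2m / p\<close> as close to 1 as needed. Every block and every clause then demands that the deleted
  set includes one of a list of such sets. This is enforced by cliques attached to the modulator, whose
  optimal deletions leave star forests if the demand is met, and cannot destroy all triangles if
  it is not. As star forests are both acyclic and bipartite, and acyclic and bipartite graphs are
  triangle-free, one construction serves both problems.
\<close>

section \<open>Polynomial time on WHILE programs\<close>

text \<open>A superset of a satisfying set also satisfies, so "deleted" versus "kept" cannot stand
  for a truth value. Two modulator vertices per variable, one for each value, would repair this, but
  they double the parameter and exclude only bases below \<open>sqrt 2\<close>. Sets of equal size
  are pairwise incomparable as well, and \<open>2 * m\<close> elements have at least
  \<open>4 ^ m / (2 * m)\<close> subsets of size \<open>m\<close>, so almost one bit per vertex is
  stored. No gadget enforces the size from above: each block demand costs at least \<open>m\<close>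
  deletions in its own block, and the budget for the modulator is exactly \<open>m\<close> per
  block. The numbers \<open>p\<close> and \<open>m\<close> depend on \<epsilon> alone. Hence
  \<open>2 ^ p\<close> is a constant, and a code known to exist only by counting can be built into
  the program as a table. They do not depend on \<open>q\<close> either, so a single exponent below
  1 serves all \<open>q\<close>, which is what contradicts the hypothesis. Hypothesis and conclusion
  speak about concrete programs, so the reduction has to be a program too. It is never written out:
  \<open>poly_time\<close> asserts its existence, and closure rules for list functions derive it
  from the definition of the reduction.\<close>

lemma poly_nat_mono: "m \<le> n \<Longrightarrow> poly (p :: nat poly) m \<le> poly p n"
  by (induction p) (simp_all add: mult_le_mono)

text \<open>Polynomials over \<open>nat\<close> have no negative coefficients and so are monotone,
  which lets bounds be composed. The bound holds for all values of the type, not only for the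
  instances of a problem, so the closure rules carry no side conditions.\<close>

definition poly_bounded :: "('a \<Rightarrow> tree) \<Rightarrow> ('a \<Rightarrow> nat) \<Rightarrow> bool" where
  "poly_bounded e b \<longleftrightarrow> (\<exists>p :: nat poly. \<forall>x. b x \<le> poly p (size (e x)))"

named_theorems poly_bounded_intros

lemma poly_bounded_const [poly_bounded_intros]: "poly_bounded e (\<lambda>x. k)"
  unfolding poly_bounded_def by (rule exI[of _ "[:k:]"]) simp

lemma poly_bounded_size [poly_bounded_intros]: "poly_bounded e (\<lambda>x. size (e x))"
  unfolding poly_bounded_def by (rule exI[of _ "[:0, 1:]"]) simp

lemma poly_bounded_add [poly_bounded_intros]:
  assumes "poly_bounded e a" and "poly_bounded e b"
  shows "poly_bounded e (\<lambda>x. a x + b x)"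
proof -
  obtain p q where "\<And>x. a x \<le> poly p (size (e x))" "\<And>x. b x \<le> poly q (size (e x))"
    using assms unfolding poly_bounded_def by blast
  then show ?thesis unfolding poly_bounded_def
    by (intro exI[of _ "p + q"]) (simp add: add_mono)
qed

lemma poly_bounded_mult [poly_bounded_intros]:
  assumes "poly_bounded e a" and "poly_bounded e b"
  shows "poly_bounded e (\<lambda>x. a x * b x)"
proof -
  obtain p q where "\<And>x. a x \<le> poly p (size (e x))" "\<And>x. b x \<le> poly q (size (e x))"
    using assms unfolding poly_bounded_def by blast
  then show ?thesis unfolding poly_bounded_def
    by (intro exI[of _ "p * q"]) (simp add: mult_mono)
qed

lemma poly_bounded_Suc [poly_bounded_intros]:
  "poly_bounded e a \<Longrightarrow> poly_bounded e (\<lambda>x. Suc (a x))"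
  using poly_bounded_add[OF _ poly_bounded_const[of e 1]] by simp

lemma poly_bounded_le:
  assumes "poly_bounded e b" and "\<And>x. a x \<le> b x"
  shows "poly_bounded e a"
  using assms unfolding poly_bounded_def by (meson order_trans)

lemma poly_bounded_poly [poly_bounded_intros]:
  assumes "poly_bounded e b"
  shows "poly_bounded e (\<lambda>x. poly p (b x))"
proof -
  obtain q where "\<And>x. b x \<le> poly q (size (e x))"
    using assms unfolding poly_bounded_def by blast
  then show ?thesis unfolding poly_bounded_def
    by (intro exI[of _ "pcompose p q"]) (simp add: poly_pcompose poly_nat_mono)
qed

lemma poly_bounded_comp:
  assumes "poly_bounded e' b" and "poly_bounded e (\<lambda>x. size (e' (f x)))"
  shows "poly_bounded e (\<lambda>x. b (f x))"
proof -
  obtain q where "\<And>y. b y \<le> poly q (size (e' y))"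
    using assms(1) unfolding poly_bounded_def by blast
  then show ?thesis
    by (intro poly_bounded_le[OF poly_bounded_poly[OF assms(2), of q]])
qed

section \<open>Renaming variables and calling subprograms\<close>

primrec rename :: "(nat \<Rightarrow> nat) \<Rightarrow> exp \<Rightarrow> exp" where
  "rename r (Var x) = Var (r x)"
| "rename r Nil_exp = Nil_exp"
| "rename r (Cons_exp a b) = Cons_exp (rename r a) (rename r b)"
| "rename r (Hd_exp a) = Hd_exp (rename r a)"
| "rename r (Tl_exp a) = Tl_exp (rename r a)"

primrec rename_com :: "(nat \<Rightarrow> nat) \<Rightarrow> com \<Rightarrow> com" where
  "rename_com r (Assign x e) = Assign (r x) (rename r e)"
| "rename_com r (Seq c d) = Seq (rename_com r c) (rename_com r d)"
| "rename_com r (Cond e c d) = Cond (rename r e) (rename_com r c) (rename_com r d)"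
| "rename_com r (While e c) = While (rename r e) (rename_com r c)"

lemma cost_exp_rename [simp]: "cost_exp (rename r e) = cost_exp e"
  by (induction e) auto

lemma eval_exp_rename: "(\<And>x. z (r x) = s x) \<Longrightarrow> eval_exp (rename r e) z = eval_exp e s"
  by (induction e) auto

text \<open>All variables are global. Injectivity keeps the renamed variables apart, and everything
  outside \<open>range r\<close> survives the run, so a caller can store its own data there.\<close>

lemma exec_rename:
  assumes "exec c s t s'" and "inj r" and "\<And>x. z (r x) = s x"
  shows "\<exists>z'. exec (rename_com r c) z t z' \<and> (\<forall>x. z' (r x) = s' x) \<and>
    (\<forall>y. y \<notin> range r \<longrightarrow> z' y = z y)"
  using assms(1,3)
proof (induction arbitrary: z rule: exec.induct)
  case (Assign x e s)
  have "exec (rename_com r (Assign x e)) z (cost_exp e + 1) (z(r x := eval_exp e s))"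
    using exec.Assign[of "r x" "rename r e" z] eval_exp_rename[of z r s e, OF Assign] by simp
  moreover have "(z(r x := eval_exp e s)) (r y) = (s(x := eval_exp e s)) y" for y
    using Assign inj_eq[OF assms(2)] by simp
  moreover have "(z(r x := eval_exp e s)) y = z y" if "y \<notin> range r" for y
    using that by auto
  ultimately show ?case by blast
next
  case (Seq c1 s t1 s' c2 t2 s'')
  obtain z1 where z1: "exec (rename_com r c1) z t1 z1" "\<forall>x. z1 (r x) = s' x"
    "\<forall>y. y \<notin> range r \<longrightarrow> z1 y = z y" using Seq.IH(1)[OF Seq.prems] by blast
  obtain z2 where "exec (rename_com r c2) z1 t2 z2" "\<forall>x. z2 (r x) = s'' x"
    "\<forall>y. y \<notin> range r \<longrightarrow> z2 y = z1 y" using Seq.IH(2)[of z1] z1(2) by blast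
  with z1 show ?case by (intro exI[of _ z2]) (auto intro: exec.Seq)
next
  case (Cond_true e s c1 t s' c2)
  have "eval_exp (rename r e) z \<noteq> Leaf" using Cond_true eval_exp_rename[of z r s e] by simp
  moreover obtain z' where "exec (rename_com r c1) z t z'" "\<forall>x. z' (r x) = s' x"
    "\<forall>y. y \<notin> range r \<longrightarrow> z' y = z y" using Cond_true.IH[OF Cond_true.prems] by blast
  ultimately show ?case
    using exec.Cond_true[of "rename r e" z "rename_com r c1" t z'] by (intro exI[of _ z']) simp
next
  case (Cond_false e s c2 t s' c1)
  have "eval_exp (rename r e) z = Leaf" using Cond_false eval_exp_rename[of z r s e] by simp
  moreover obtain z' where "exec (rename_com r c2) z t z'" "\<forall>x. z' (r x) = s' x"
    "\<forall>y. y \<notin> range r \<longrightarrow> z' y = z y" using Cond_false.IH[OF Cond_false.prems] by blast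
  ultimately show ?case
    using exec.Cond_false[of "rename r e" z "rename_com r c2" t z'] by (intro exI[of _ z']) simp
next
  case (While_false e s c)
  have "eval_exp (rename r e) z = Leaf" using While_false eval_exp_rename[of z r s e] by simp
  then show ?case
    using exec.While_false[of "rename r e" z "rename_com r c"] While_false.prems
    by (intro exI[of _ z]) simp
next
  case (While_true e s c t1 s' t2 s'')
  have "eval_exp (rename r e) z \<noteq> Leaf" using While_true eval_exp_rename[of z r s e] by simp
  moreover obtain z1 where z1: "exec (rename_com r c) z t1 z1" "\<forall>x. z1 (r x) = s' x"
    "\<forall>y. y \<notin> range r \<longrightarrow> z1 y = z y" using While_true.IH(1)[OF While_true.prems] by blast
  moreover obtain z2 where z2: "exec (rename_com r (While e c)) z1 t2 z2" "\<forall>x. z2 (r x) = s'' x"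
    "\<forall>y. y \<notin> range r \<longrightarrow> z2 y = z1 y" using While_true.IH(2)[of z1] z1(2) by blast
  ultimately have "exec (rename_com r (While e c)) z (cost_exp e + 1 + t1 + t2) z2"
    using exec.While_true[of "rename r e" z "rename_com r c" t1 z1 t2 z2] by simp
  with z1 z2 show ?case by (intro exI[of _ z2]) auto
qed

text \<open>Variables 0, 1, 2 hold local data while a program renamed to the variables from 3 on is called.\<close>

definition frame :: "tree \<Rightarrow> tree \<Rightarrow> tree \<Rightarrow> tree \<Rightarrow> state" where
  "frame a b c d = (\<lambda>x. if x = 0 then a else if x = 1 then b else if x = 2 then c
     else if x = 3 then d else Leaf)"

lemma frame_simps [simp]:
  "frame a b c d 0 = a" "frame a b c d (Suc 0) = b" "frame a b c d 2 = c" "frame a b c d 3 = d"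
  "(frame a b c d)(0 := v) = frame v b c d" "(frame a b c d)(Suc 0 := v) = frame a v c d"
  "(frame a b c d)(2 := v) = frame a b v d" "(frame a b c d)(3 := v) = frame a b c v"
  by (auto simp: frame_def)

lemma init_state_frame: "init_state d = frame d Leaf Leaf Leaf"
  by (auto simp: frame_def init_state_def)

definition call :: "com \<Rightarrow> com" where
  "call = rename_com ((+) 3)"

lemma exec_call:
  assumes "exec c (init_state d) t (init_state d')"
  shows "exec (call c) (frame u v w d) t (frame u v w d')"
proof -
  have "frame u v w d (3 + x) = init_state d x" for x
    by (simp add: frame_def init_state_def)
  from exec_rename[OF assms, of "(+) 3" "frame u v w d", OF _ this]
  obtain z where z: "exec (call c) (frame u v w d) t z" "\<forall>x. z (3 + x) = init_state d' x"
    "\<forall>y. y \<notin> range ((+) 3) \<longrightarrow> z y = frame u v w d y"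
    unfolding call_def by auto
  have "z y = frame u v w d' y" for y
  proof (cases "y < 3")
    case True
    then have "y \<notin> range ((+) 3)" by auto
    then show ?thesis using z(3) True by (auto simp: frame_def)
  next
    case False
    then obtain x where "y = 3 + x" using le_Suc_ex not_less by blast
    then show ?thesis using z(2) by (auto simp: frame_def init_state_def)
  qed
  then have "z = frame u v w d'" by blast
  then show ?thesis using z(1) by simp
qed

section \<open>Functions computable in polynomial time\<close>

lemma exec_assign:
  assumes "s(x := eval_exp e s) = s'" and "cost_exp e + 1 = t"
  shows "exec (Assign x e) s t s'"
  using exec.Assign[of x e s] assms by simp

text \<open>The final state is again of the form \<open>init_state\<close>, with all scratch
  variables reset, so that programs compose by \<open>Seq\<close>. The bound on the output does not
  follow from the bound on the time: \<open>Cons_exp\<close> shares its arguments, and repeated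
  doubling builds a tree of exponential size.\<close>

definition poly_time :: "('a \<Rightarrow> tree) \<Rightarrow> ('b \<Rightarrow> tree) \<Rightarrow> ('a \<Rightarrow> 'b) \<Rightarrow> bool" where
  "poly_time e e' f \<longleftrightarrow> (\<exists>c T. (\<forall>x. \<exists>t \<le> T x. exec c (init_state (e x)) t (init_state (e' (f x))))
     \<and> poly_bounded e T \<and> poly_bounded e (\<lambda>x. size (e' (f x))))"

named_theorems poly_time_intros

lemma poly_time_size: "poly_time e e' f \<Longrightarrow> poly_bounded e (\<lambda>x. size (e' (f x)))"
  unfolding poly_time_def by blast

lemma poly_timeD:
  assumes "poly_time e e' f"
  shows "\<exists>c T. (\<forall>x. \<exists>t \<le> T x. exec c (init_state (e x)) t (init_state (e' (f x)))) \<and>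
    poly_bounded e T"
  using assms unfolding poly_time_def by blast

lemma poly_time_exp:
  assumes "\<And>x. eval_exp a (init_state (e x)) = e' (f x)"
    and "poly_bounded e (\<lambda>x. size (e' (f x)))"
  shows "poly_time e e' f"
proof -
  have "exec (Assign 0 a) (init_state (e x)) (cost_exp a + 1) (init_state (e' (f x)))" for x
    unfolding init_state_frame
    by (rule exec_assign) (use assms(1) in \<open>simp_all add: init_state_frame\<close>)
  then show ?thesis unfolding poly_time_def
    using assms(2) poly_bounded_const[of e "cost_exp a + 1"]
    by (intro exI[of _ "Assign 0 a"] exI[of _ "\<lambda>_. cost_exp a + 1"]) blast
qed

lemma poly_time_id [poly_time_intros]: "poly_time e e (\<lambda>x. x)"
  by (rule poly_time_exp[of "Var 0"]) (simp_all add: init_state_def poly_bounded_size)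

lemma exists_const_exp: "\<exists>a. \<forall>s. eval_exp a s = d"
proof (induction d)
  case Leaf
  show ?case by (rule exI[of _ Nil_exp]) simp
next
  case (Node l r)
  then obtain a b where "\<forall>s. eval_exp a s = l" "\<forall>s. eval_exp b s = r" by blast
  then show ?case by (intro exI[of _ "Cons_exp a b"]) simp
qed

lemma poly_time_const [poly_time_intros]: "poly_time e e' (\<lambda>x. k)"
proof -
  obtain a where "\<forall>s. eval_exp a s = e' k" using exists_const_exp by blast
  then show ?thesis by (intro poly_time_exp[of a]) (simp_all add: poly_bounded_const)
qed

lemma poly_time_comp:
  assumes "poly_time e e' f" and "poly_time e' e'' g"
  shows "poly_time e e'' (\<lambda>x. g (f x))"
proof -
  obtain c T where c: "\<forall>x. \<exists>t \<le> T x. exec c (init_state (e x)) t (init_state (e' (f x)))"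
    "poly_bounded e T" using poly_timeD[OF assms(1)] by blast
  obtain d U where d: "\<forall>x. \<exists>t \<le> U x. exec d (init_state (e' x)) t (init_state (e'' (g x)))"
    "poly_bounded e' U" using poly_timeD[OF assms(2)] by blast
  have "\<exists>t \<le> T x + U (f x). exec (Seq c d) (init_state (e x)) t (init_state (e'' (g (f x))))" for x
  proof -
    obtain t u where "t \<le> T x" "exec c (init_state (e x)) t (init_state (e' (f x)))"
      "u \<le> U (f x)" "exec d (init_state (e' (f x))) u (init_state (e'' (g (f x))))"
      using c(1) d(1) by blast
    then show ?thesis by (intro exI[of _ "t + u"]) (auto intro: exec.Seq)
  qed
  moreover have "poly_bounded e (\<lambda>x. T x + U (f x))"
    by (rule poly_bounded_add[OF c(2) poly_bounded_comp[OF d(2) poly_time_size[OF assms(1)]]])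
  moreover have "poly_bounded e (\<lambda>x. size (e'' (g (f x))))"
    by (rule poly_bounded_comp[OF poly_time_size[OF assms(2)] poly_time_size[OF assms(1)]])
  ultimately show ?thesis unfolding poly_time_def
    by (intro exI[of _ "Seq c d"] exI[of _ "\<lambda>x. T x + U (f x)"]) blast
qed

lemma enc_pair_eq: "enc_pair e e' z = Node (e (fst z)) (e' (snd z))"
  by (cases z) simp

lemma poly_time_pair [poly_time_intros]:
  assumes "poly_time e e1 f" and "poly_time e e2 g"
  shows "poly_time e (enc_pair e1 e2) (\<lambda>x. (f x, g x))"
proof -
  obtain c T where c: "\<forall>x. \<exists>t \<le> T x. exec c (init_state (e x)) t (init_state (e1 (f x)))"
    "poly_bounded e T" using poly_timeD[OF assms(1)] by blast
  obtain d U where d: "\<forall>x. \<exists>t \<le> U x. exec d (init_state (e x)) t (init_state (e2 (g x)))"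
    "poly_bounded e U" using poly_timeD[OF assms(2)] by blast
  define pr where "pr = Seq (Assign 3 (Var 0)) (Seq (call c)
    (Seq (Seq (Assign 1 (Var 3)) (Assign 3 Nil_exp)) (Seq (Assign 3 (Var 0)) (Seq (call d) (Seq (Assign 0 (Cons_exp (Var 1) (Var 3)))
    (Seq (Assign 1 Nil_exp) (Assign 3 Nil_exp)))))))"
  have "\<exists>t \<le> T x + U x + 20. exec pr (init_state (e x)) t
      (init_state (enc_pair e1 e2 (f x, g x)))" for x
  proof -
    obtain t u where t: "t \<le> T x" "u \<le> U x"
      "exec c (init_state (e x)) t (init_state (e1 (f x)))"
      "exec d (init_state (e x)) u (init_state (e2 (g x)))" using c(1) d(1) by blast
    note call = exec_call[OF t(3)] exec_call[OF t(4)]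
    have 1: "exec (Assign 3 (Var 0)) (frame (e x) b Leaf Leaf) 2 (frame (e x) b Leaf (e x))" for b
      by (rule exec_assign) simp_all
    have 2: "exec (Seq (Assign 1 (Var 3)) (Assign 3 Nil_exp)) (frame (e x) Leaf Leaf (e1 (f x))) (2 + 2)
        (frame (e x) (e1 (f x)) Leaf Leaf)"
      by (rule exec.Seq[of _ _ _ "frame (e x) (e1 (f x)) Leaf (e1 (f x))"]; rule exec_assign) simp_all
    have 3: "exec (Assign 0 (Cons_exp (Var 1) (Var 3))) (frame (e x) (e1 (f x)) Leaf (e2 (g x))) 4
        (frame (enc_pair e1 e2 (f x, g x)) (e1 (f x)) Leaf (e2 (g x)))"
      by (rule exec_assign) simp_all
    have 4: "exec (Assign 1 Nil_exp) (frame a b Leaf d) 2 (frame a Leaf Leaf d)" for a b d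
      by (rule exec_assign) simp_all
    have 5: "exec (Assign 3 Nil_exp) (frame a Leaf Leaf d) 2 (frame a Leaf Leaf Leaf)" for a d
      by (rule exec_assign) simp_all
    note exec.Seq[OF 1 exec.Seq[OF call(1) exec.Seq[OF 2 exec.Seq[OF 1 exec.Seq[OF call(2)
      exec.Seq[OF 3 exec.Seq[OF 4 5]]]]]]]
    then have "exec pr (init_state (e x)) (2 + (t + (2 + 2 + (2 + (u + (4 + (2 + 2)))))))
        (init_state (enc_pair e1 e2 (f x, g x)))"
      unfolding pr_def init_state_frame .
    then show ?thesis using t(1,2) by (intro exI conjI) auto
  qed
  moreover have "poly_bounded e (\<lambda>x. T x + U x + 20)"
    by (intro poly_bounded_add poly_bounded_const c(2) d(2))
  moreover have "poly_bounded e (\<lambda>x. size (enc_pair e1 e2 (f x, g x)))"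
    unfolding enc_pair.simps tree.size
    by (intro poly_bounded_intros poly_time_size[OF assms(1)] poly_time_size[OF assms(2)])
  ultimately show ?thesis unfolding poly_time_def
    by (intro exI[of _ pr] exI[of _ "\<lambda>x. T x + U x + 20"]) blast
qed

lemma poly_time_fst [poly_time_intros]:
  assumes "poly_time e (enc_pair e1 e2) f"
  shows "poly_time e e1 (\<lambda>x. fst (f x))"
proof -
  have "poly_time (enc_pair e1 e2) e1 fst"
    by (rule poly_time_exp[of "Hd_exp (Var 0)"])
      (simp add: init_state_def enc_pair_eq,
       rule poly_bounded_le[OF poly_bounded_size], simp add: enc_pair_eq)
  then show ?thesis by (rule poly_time_comp[OF assms])
qed

lemma poly_time_snd [poly_time_intros]:
  assumes "poly_time e (enc_pair e1 e2) f"
  shows "poly_time e e2 (\<lambda>x. snd (f x))"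
proof -
  have "poly_time (enc_pair e1 e2) e2 snd"
    by (rule poly_time_exp[of "Tl_exp (Var 0)"])
      (simp add: init_state_def enc_pair_eq,
       rule poly_bounded_le[OF poly_bounded_size], simp add: enc_pair_eq)
  then show ?thesis by (rule poly_time_comp[OF assms])
qed

text \<open>Time is measured on trees, so functions of different types with the same encoded values
  share a program. This identifies a nonempty list with a pair and a unary number with a list of
  units.\<close>

lemma poly_time_cong_enc:
  assumes "poly_time e e1 f" and "\<And>x. e1 (f x) = e2 (g x)"
  shows "poly_time e e2 g"
  using assms unfolding poly_time_def by simp

text \<open>Every tree other than \<open>Leaf\<close> counts as true, so one program serves both for
  branching on a Boolean and for testing a unary number for zero. It works on the pair of condition
  and input, because computing the condition alone would lose the input.\<close>

lemma poly_time_if_tree: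
  assumes "poly_time e e' v" and "\<And>x. e' (v x) \<noteq> Leaf \<longleftrightarrow> b x"
    and "poly_time e e1 f" and "poly_time e e1 g"
  shows "poly_time e e1 (\<lambda>x. if b x then f x else g x)"
proof -
  let ?e = "enc_pair e' e"
  obtain c T where c: "\<forall>x. \<exists>t \<le> T x. exec c (init_state (e x)) t (init_state (e1 (f x)))"
    "poly_bounded e T" using poly_timeD[OF assms(3)] by blast
  obtain d U where d: "\<forall>x. \<exists>t \<le> U x. exec d (init_state (e x)) t (init_state (e1 (g x)))"
    "poly_bounded e U" using poly_timeD[OF assms(4)] by blast
  define a where "a = Assign 0 (Tl_exp (Var 0))"
  define pr where "pr = Cond (Hd_exp (Var 0)) (Seq a c) (Seq a d)"
  let ?h = "\<lambda>z. if e' (fst z) \<noteq> Leaf then f (snd z) else g (snd z)"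
  have "\<exists>t \<le> T (snd z) + U (snd z) + 6. exec pr (init_state (?e z)) t (init_state (e1 (?h z)))" for z
  proof -
    have a: "exec a (init_state (?e z)) 3 (init_state (e (snd z)))"
      unfolding a_def init_state_frame by (rule exec_assign) (simp_all add: enc_pair_eq)
    obtain t u where t: "t \<le> T (snd z)" "u \<le> U (snd z)"
      "exec c (init_state (e (snd z))) t (init_state (e1 (f (snd z))))"
      "exec d (init_state (e (snd z))) u (init_state (e1 (g (snd z))))" using c(1) d(1) by blast
    have hd: "eval_exp (Hd_exp (Var 0)) (init_state (?e z)) = e' (fst z)"
      by (simp add: init_state_def enc_pair_eq)
    show ?thesis
    proof (cases "e' (fst z) = Leaf")
      case True
      then show ?thesis
        using exec.Cond_false[OF _ exec.Seq[OF a t(4)], of "Hd_exp (Var 0)" "Seq a c"] hd t(2)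
        by (intro exI[of _ "cost_exp (Hd_exp (Var 0)) + 1 + (3 + u)"]) (simp add: pr_def)
    next
      case False
      then show ?thesis
        using exec.Cond_true[OF _ exec.Seq[OF a t(3)], of "Hd_exp (Var 0)" "Seq a d"] hd t(1)
        by (intro exI[of _ "cost_exp (Hd_exp (Var 0)) + 1 + (3 + t)"]) (simp add: pr_def)
    qed
  qed
  moreover have sz: "poly_bounded ?e (\<lambda>z. size (e (snd z)))"
    by (rule poly_bounded_le[OF poly_bounded_size]) (simp add: enc_pair_eq)
  have "poly_bounded ?e (\<lambda>z. T (snd z) + U (snd z) + 6)"
    by (intro poly_bounded_add poly_bounded_const poly_bounded_comp[OF c(2) sz]
      poly_bounded_comp[OF d(2) sz])
  moreover have "poly_bounded ?e (\<lambda>z. size (e1 (f (snd z))) + size (e1 (g (snd z))))"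
    by (intro poly_bounded_add poly_bounded_comp[OF poly_time_size[OF assms(3)] sz]
      poly_bounded_comp[OF poly_time_size[OF assms(4)] sz])
  then have "poly_bounded ?e (\<lambda>z. size (e1 (?h z)))"
    by (rule poly_bounded_le) simp
  ultimately have "poly_time ?e e1 ?h" unfolding poly_time_def
    by (intro exI[of _ pr] exI[of _ "\<lambda>z. T (snd z) + U (snd z) + 6"]) blast
  from poly_time_comp[OF poly_time_pair[OF assms(1) poly_time_id] this]
  show ?thesis by (simp only: fst_conv snd_conv assms(2))
qed

lemma poly_time_if_bool [poly_time_intros]:
  assumes "poly_time e enc_bool b" and "poly_time e e1 f" and "poly_time e e1 g"
  shows "poly_time e e1 (\<lambda>x. if b x then f x else g x)"
  by (rule poly_time_if_tree[OF assms(1) _ assms(2,3)]) (simp add: enc_bool_def)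

text \<open>Accumulator-passing recursion stays polynomial only if all intermediate states are small:
  one assignment can double the size of a tree.\<close>

lemma poly_time_fold:
  assumes xs: "poly_time e (enc_list ea) xs" and init: "poly_time e es i"
    and step: "poly_time (enc_pair e (enc_pair ea es)) es (\<lambda>z. h (fst z) (fst (snd z)) (snd (snd z)))"
    and bound: "poly_bounded e b"
    and small: "\<And>x ys zs. xs x = ys @ zs \<Longrightarrow> size (es (fold (h x) ys (i x))) \<le> b x"
  shows "poly_time e es (\<lambda>x. fold (h x) (xs x) (i x))"
proof -
  let ?e = "enc_pair e (enc_pair ea es)"
  obtain c T where c: "\<forall>z. \<exists>t \<le> T z. exec c (init_state (?e z)) t
      (init_state (es (h (fst z) (fst (snd z)) (snd (snd z)))))"
    "poly_bounded ?e T" using poly_timeD[OF step] by blast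
  obtain p where p: "\<And>z. T z \<le> poly p (size (?e z))"
    using c(2) unfolding poly_bounded_def by blast
  let ?e' = "enc_pair e (enc_pair (enc_list ea) es)"
  obtain c0 T0 where c0: "\<forall>x. \<exists>t \<le> T0 x. exec c0 (init_state (e x)) t
      (init_state (?e' (x, xs x, i x)))" "poly_bounded e T0"
    using poly_timeD[OF poly_time_pair[OF poly_time_id poly_time_pair[OF xs init]]] by blast
  \<comment> \<open>Variable 0 keeps \<open>x\<close>, variable 1 the rest of the list and variable
    2 the accumulator; variable 3 passes the argument to the step program and receives its
    result.\<close>
  define body where "body = Seq (Assign 3 (Cons_exp (Var 0) (Cons_exp (Hd_exp (Var 1)) (Var 2))))
    (Seq (call c) (Seq (Assign 2 (Var 3)) (Assign 1 (Tl_exp (Var 1)))))"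
  define pr where "pr = Seq c0 (Seq (Assign 1 (Hd_exp (Tl_exp (Var 0))))
    (Seq (Assign 2 (Tl_exp (Tl_exp (Var 0)))) (Seq (Assign 0 (Hd_exp (Var 0)))
    (Seq (While (Var 1) body) (Seq (Assign 0 (Var 2)) (Seq (Assign 2 Nil_exp) (Assign 3 Nil_exp)))))))"
  \<comment> \<open>Bounds one pass of the loop for every element of the list: the 2 counts the
    cells of the two pairs in the argument of the call, and the final summand covers the assignments
    around the call.\<close>
  define K where "K x = poly p (size (e x) + size (enc_list ea (xs x)) + b x + 2) + 15" for x
  have body: "\<exists>t \<le> K x. exec body (frame (e x) (enc_list ea (y # zs)) (es (fold (h x) ys (i x))) d) t
      (frame (e x) (enc_list ea zs) (es (fold (h x) (ys @ [y]) (i x)))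
        (es (fold (h x) (ys @ [y]) (i x))))"
    if "xs x = ys @ y # zs" for x ys y zs d
  proof -
    let ?s = "fold (h x) ys (i x)" and ?s' = "fold (h x) (ys @ [y]) (i x)"
    obtain t where t: "t \<le> T (x, y, ?s)" "exec c (init_state (?e (x, y, ?s))) t (init_state (es ?s'))"
      using c(1)[rule_format, of "(x, y, ?s)"]
      unfolding fst_conv snd_conv fold_append fold_simps comp_apply by blast
    have 1: "exec (Assign 3 (Cons_exp (Var 0) (Cons_exp (Hd_exp (Var 1)) (Var 2))))
      (frame (e x) (enc_list ea (y # zs)) (es ?s) d) 7
      (frame (e x) (enc_list ea (y # zs)) (es ?s) (?e (x, y, ?s)))"
      by (rule exec_assign) simp_all
    have 2: "exec (Assign 2 (Var 3)) (frame (e x) (enc_list ea (y # zs)) (es ?s) (es ?s')) 2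
      (frame (e x) (enc_list ea (y # zs)) (es ?s') (es ?s'))"
      by (rule exec_assign) simp_all
    have 3: "exec (Assign 1 (Tl_exp (Var 1))) (frame (e x) (enc_list ea (y # zs)) (es ?s') (es ?s')) 3
      (frame (e x) (enc_list ea zs) (es ?s') (es ?s'))"
      by (rule exec_assign) simp_all
    have "size (ea y) \<le> size (enc_list ea (us @ y # zs))" for us
      by (induction us) auto
    then have "size (ea y) \<le> size (enc_list ea (xs x))" unfolding that .
    moreover have "size (es ?s) \<le> b x" by (rule small[OF that])
    ultimately have "size (?e (x, y, ?s)) \<le> size (e x) + size (enc_list ea (xs x)) + b x + 2"
      unfolding enc_pair.simps tree.size by linarith
    then have "t + 12 \<le> K x"
      using t(1) p[of "(x, y, ?s)"]
        poly_nat_mono[of "size (?e (x, y, ?s))" "size (e x) + size (enc_list ea (xs x)) + b x + 2" p]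
      unfolding K_def by linarith
    with exec.Seq[OF 1 exec.Seq[OF exec_call[OF t(2)] exec.Seq[OF 2 3]]]
    show ?thesis unfolding body_def by (intro exI[of _ "7 + (t + (2 + 3))"]) simp
  qed
  have loop: "\<exists>t d'. t \<le> length zs * (K x + 2) + 2 \<and>
      exec (While (Var 1) body) (frame (e x) (enc_list ea zs) (es (fold (h x) ys (i x))) d) t
        (frame (e x) Leaf (es (fold (h x) (xs x) (i x))) d')"
    if "xs x = ys @ zs" for x ys zs d
    using that
  proof (induction zs arbitrary: ys d)
    case Nil
    have "exec (While (Var 1) body) (frame (e x) Leaf (es (fold (h x) ys (i x))) d)
        (cost_exp (Var 1) + 1) (frame (e x) Leaf (es (fold (h x) ys (i x))) d)"
      by (rule exec.While_false) simp
    with Nil show ?case by (intro exI[of _ "cost_exp (Var 1) + 1"] exI[of _ d]) simp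
  next
    case (Cons y zs)
    let ?s' = "fold (h x) (ys @ [y]) (i x)"
    obtain t1 where t1: "t1 \<le> K x" "exec body
      (frame (e x) (enc_list ea (y # zs)) (es (fold (h x) ys (i x))) d) t1
      (frame (e x) (enc_list ea zs) (es ?s') (es ?s'))" using body[OF Cons.prems] by blast
    obtain t2 d' where t2: "t2 \<le> length zs * (K x + 2) + 2" "exec (While (Var 1) body)
      (frame (e x) (enc_list ea zs) (es ?s') (es ?s')) t2
      (frame (e x) Leaf (es (fold (h x) (xs x) (i x))) d')"
      using Cons.IH[of "ys @ [y]" "es ?s'"] Cons.prems
      unfolding append_assoc append_Cons append_Nil by blast
    have "exec (While (Var 1) body) (frame (e x) (enc_list ea (y # zs)) (es (fold (h x) ys (i x))) d)
        (cost_exp (Var 1) + 1 + t1 + t2) (frame (e x) Leaf (es (fold (h x) (xs x) (i x))) d')"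
      by (rule exec.While_true[OF _ t1(2) t2(2)]) simp
    moreover have "cost_exp (Var 1) + 1 + t1 + t2 \<le> length (y # zs) * (K x + 2) + 2"
      using t1(1) t2(1) by simp
    ultimately show ?case by blast
  qed
  have len: "length ys \<le> size (enc_list ea ys)" for ys :: "'b list"
    by (induction ys) auto
  let ?T = "\<lambda>x. T0 x + size (enc_list ea (xs x)) * (K x + 2) + 30"
  have "\<exists>t \<le> ?T x. exec pr (init_state (e x)) t (init_state (es (fold (h x) (xs x) (i x))))" for x
  proof -
    let ?r = "fold (h x) (xs x) (i x)"
    from c0(1)[rule_format, of x] obtain t0 where t0: "t0 \<le> T0 x"
      "exec c0 (init_state (e x)) t0 (init_state (?e' (x, xs x, i x)))" by blast
    note t0' = t0(2)[unfolded init_state_frame[of "?e' (x, xs x, i x)"]]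
    have 1: "exec (Assign 1 (Hd_exp (Tl_exp (Var 0)))) (frame (?e' (x, xs x, i x)) Leaf Leaf Leaf) 4
      (frame (?e' (x, xs x, i x)) (enc_list ea (xs x)) Leaf Leaf)"
      by (rule exec_assign) simp_all
    have 2: "exec (Assign 2 (Tl_exp (Tl_exp (Var 0))))
      (frame (?e' (x, xs x, i x)) (enc_list ea (xs x)) Leaf Leaf) 4
      (frame (?e' (x, xs x, i x)) (enc_list ea (xs x)) (es (i x)) Leaf)"
      by (rule exec_assign) simp_all
    have 3: "exec (Assign 0 (Hd_exp (Var 0)))
      (frame (?e' (x, xs x, i x)) (enc_list ea (xs x)) (es (i x)) Leaf) 3
      (frame (e x) (enc_list ea (xs x)) (es (i x)) Leaf)"
      by (rule exec_assign) simp_all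
    obtain t d where t: "t \<le> length (xs x) * (K x + 2) + 2"
      "exec (While (Var 1) body) (frame (e x) (enc_list ea (xs x)) (es (i x)) Leaf) t
        (frame (e x) Leaf (es ?r) d)" using loop[of x "[]" "xs x" Leaf]
      unfolding append_Nil fold_simps by blast
    have 4: "exec (Assign 0 (Var 2)) (frame (e x) Leaf (es ?r) d) 2 (frame (es ?r) Leaf (es ?r) d)"
      by (rule exec_assign) simp_all
    have 5: "exec (Assign 2 Nil_exp) (frame (es ?r) Leaf (es ?r) d) 2 (frame (es ?r) Leaf Leaf d)"
      by (rule exec_assign) simp_all
    have 6: "exec (Assign 3 Nil_exp) (frame (es ?r) Leaf Leaf d) 2 (init_state (es ?r))"
      unfolding init_state_frame by (rule exec_assign) simp_all
    have "length (xs x) * (K x + 2) \<le> size (enc_list ea (xs x)) * (K x + 2)"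
      by (rule mult_le_mono1[OF len])
    from add_mono[OF t0(1) order_trans[OF t(1) add_right_mono[OF this]]]
    have "t0 + (4 + (4 + (3 + (t + (2 + (2 + 2)))))) \<le> ?T x" by simp
    moreover have "exec pr (init_state (e x)) (t0 + (4 + (4 + (3 + (t + (2 + (2 + 2)))))))
        (init_state (es ?r))"
      unfolding pr_def
      by (rule exec.Seq[OF t0' exec.Seq[OF 1 exec.Seq[OF 2 exec.Seq[OF 3 exec.Seq[OF t(2)
        exec.Seq[OF 4 exec.Seq[OF 5 6]]]]]]])
    ultimately show ?thesis by blast
  qed
  moreover have "poly_bounded e ?T" unfolding K_def
    by (intro poly_bounded_add poly_bounded_mult poly_bounded_poly poly_bounded_const
      poly_bounded_size poly_time_size[OF xs] bound c0(2))
  moreover have "poly_bounded e (\<lambda>x. size (es (fold (h x) (xs x) (i x))))"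
    by (rule poly_bounded_le[OF bound]) (use small in simp)
  ultimately show ?thesis unfolding poly_time_def
    by (intro exI[of _ pr] exI[of _ ?T]) blast
qed

section \<open>List functions and unary arithmetic\<close>

lemma size_enc_nat [simp]: "size (enc_nat n) = n"
  by (induction n) auto

lemma size_enc_list_append [simp]:
  "size (enc_list e (xs @ ys)) = size (enc_list e xs) + size (enc_list e ys)"
  by (induction xs) auto

lemma size_enc_list_rev [simp]: "size (enc_list e (rev xs)) = size (enc_list e xs)"
  by (induction xs) auto

lemma length_le_size_enc_list: "length xs \<le> size (enc_list e xs)"
  by (induction xs) auto

lemma size_le_size_enc_list: "x \<in> set xs \<Longrightarrow> size (e x) \<le> size (enc_list e xs)"
  by (induction xs) auto

lemma size_enc_list_concat: "size (enc_list e (concat xss)) \<le> size (enc_list (enc_list e) xss)"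
  by (induction xss) auto

lemma size_enc_list_map:
  "(\<And>x. x \<in> set xs \<Longrightarrow> size (e (f x)) \<le> k) \<Longrightarrow> size (enc_list e (map f xs)) \<le> length xs * Suc k"
proof (induction xs)
  case (Cons x xs)
  then have "size (e (f x)) \<le> k" "size (enc_list e (map f xs)) \<le> length xs * Suc k" by simp_all
  then show ?case by simp
qed simp

lemma size_enc_list_enumerate:
  "size (enc_list (enc_pair enc_nat e) (List.enumerate n xs)) \<le>
    size (enc_list e xs) + length xs * (n + length xs + 1)"
proof (induction xs arbitrary: n)
  case (Cons x xs)
  have "length xs * (Suc n + length xs + 1) + (n + 1) \<le> length (x # xs) * (n + length (x # xs) + 1)"
    by simp
  then show ?case using Cons[of "Suc n"] by simp
qed simp

lemma poly_time_Cons [poly_time_intros]: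
  assumes "poly_time e ea a" and "poly_time e (enc_list ea) xs"
  shows "poly_time e (enc_list ea) (\<lambda>x. a x # xs x)"
  by (rule poly_time_cong_enc[OF poly_time_pair[OF assms]]) simp

lemma poly_time_tl [poly_time_intros]:
  assumes "poly_time e (enc_list ea) xs"
  shows "poly_time e (enc_list ea) (\<lambda>x. tl (xs x))"
proof -
  have tl: "enc_list ea (tl ys) = tl_tree (enc_list ea ys)" for ys by (cases ys) auto
  have "size (tl_tree d) \<le> size d" for d by (cases d) auto
  then have "poly_time (enc_list ea) (enc_list ea) tl"
    by (intro poly_time_exp[of "Tl_exp (Var 0)"] poly_bounded_le[OF poly_bounded_size])
      (simp_all add: init_state_def tl)
  then show ?thesis by (rule poly_time_comp[OF assms])
qed

lemma poly_time_Suc [poly_time_intros]: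
  assumes "poly_time e enc_nat n"
  shows "poly_time e enc_nat (\<lambda>x. Suc (n x))"
  by (rule poly_time_cong_enc[OF poly_time_pair[OF poly_time_const[of e "\<lambda>_. Leaf" "()"] assms]]) simp

text \<open>The unary encoding of a number is literally a list of units, so arithmetic is inherited
  from lists: addition from appending, multiplication from concatenation, counting loops from
  \<open>fold\<close>.\<close>

lemma poly_time_replicate_unit:
  assumes "poly_time e enc_nat n"
  shows "poly_time e (enc_list (\<lambda>_. Leaf)) (\<lambda>x. replicate (n x) ())"
proof (rule poly_time_cong_enc[OF assms])
  have "enc_nat k = enc_list (\<lambda>_. Leaf) (replicate k ())" for k
    by (induction k) simp_all
  then show "enc_nat (n x) = enc_list (\<lambda>_. Leaf) (replicate (n x) ())" for x .
qed

lemma poly_time_pred: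
  assumes "poly_time e enc_nat n"
  shows "poly_time e enc_nat (\<lambda>x. n x - 1)"
proof -
  have pred: "enc_nat (k - 1) = tl_tree (enc_nat k)" for k by (cases k) auto
  have "poly_time enc_nat enc_nat (\<lambda>k. k - 1)"
    by (intro poly_time_exp[of "Tl_exp (Var 0)"] poly_bounded_le[OF poly_bounded_size])
      (simp_all only: size_enc_nat, simp_all add: init_state_def pred[simplified])
  then show ?thesis by (rule poly_time_comp[OF assms])
qed

lemma poly_time_rev:
  assumes "poly_time e (enc_list ea) xs"
  shows "poly_time e (enc_list ea) (\<lambda>x. rev (xs x))"
proof -
  have fold: "fold (\<lambda>y s. y # s) us vs = rev us @ vs" for us vs :: "'b list"
    by (induction us arbitrary: vs) simp_all
  have "poly_time e (enc_list ea) (\<lambda>x. fold (\<lambda>y s. y # s) (xs x) [])"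
    by (rule poly_time_fold[OF assms _ _ poly_time_size[OF assms]])
      ((rule poly_time_intros)+, simp add: fold)
  then show ?thesis by (simp add: fold)
qed

lemma poly_time_append [poly_time_intros]:
  assumes "poly_time e (enc_list ea) xs" and "poly_time e (enc_list ea) ys"
  shows "poly_time e (enc_list ea) (\<lambda>x. xs x @ ys x)"
proof -
  have fold: "fold (\<lambda>y s. y # s) us vs = rev us @ vs" for us vs :: "'b list"
    by (induction us arbitrary: vs) simp_all
  have "poly_time e (enc_list ea) (\<lambda>x. fold (\<lambda>y s. y # s) (rev (xs x)) (ys x))"
  proof (rule poly_time_fold[OF poly_time_rev[OF assms(1)] assms(2)])
    show "poly_bounded e (\<lambda>x. size (enc_list ea (rev (xs x))) + size (enc_list ea (ys x)))"
      by (intro poly_bounded_add poly_time_size[OF assms(2)] poly_time_size[OF poly_time_rev[OF assms(1)]])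
    show "size (enc_list ea (fold (\<lambda>y s. y # s) us (ys x))) \<le>
        size (enc_list ea (rev (xs x))) + size (enc_list ea (ys x))"
      if "rev (xs x) = us @ vs" for x us vs
      unfolding that by (simp add: fold)
  qed (rule poly_time_intros)+
  then show ?thesis by (simp add: fold)
qed

lemma poly_time_map [poly_time_intros]:
  assumes f: "poly_time (enc_pair e ea) eb (\<lambda>z. f (fst z) (snd z))"
    and xs: "poly_time e (enc_list ea) xs"
  shows "poly_time e (enc_list eb) (\<lambda>x. map (f x) (xs x))"
proof -
  have fold: "fold (\<lambda>y s. g y # s) ys s = rev (map g ys) @ s" for g :: "'b \<Rightarrow> 'd" and ys s
    by (induction ys arbitrary: s) auto
  obtain p where p: "\<And>z. size (eb (f (fst z) (snd z))) \<le> poly p (size (enc_pair e ea z))"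
    using poly_time_size[OF f] unfolding poly_bounded_def by blast
  define n where "n x = size (enc_list ea (xs x))" for x
  \<comment> \<open>At most \<open>n x\<close> images are stored, each of a size polynomial in that
    of the pair of \<open>x\<close> and a list element.\<close>
  define b where "b x = n x * Suc (poly p (size (e x) + n x + 1))" for x
  have n: "poly_bounded e n" unfolding n_def by (rule poly_time_size[OF xs])
  have "poly_time e (enc_list eb) (\<lambda>x. fold (\<lambda>y s. f x y # s) (xs x) [])"
  proof (rule poly_time_fold[OF xs poly_time_const, where b = b])
    let ?e = "enc_pair e (enc_pair ea (enc_list eb))"
    have "poly_time ?e eb (\<lambda>z. f (fst (fst z, fst (snd z))) (snd (fst z, fst (snd z))))"
      by (rule poly_time_comp[OF _ f, of _ "\<lambda>z. (fst z, fst (snd z))"]) (rule poly_time_intros)+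
    then have "poly_time ?e eb (\<lambda>z. f (fst z) (fst (snd z)))" by simp
    then show "poly_time ?e (enc_list eb) (\<lambda>z. f (fst z) (fst (snd z)) # snd (snd z))"
      by (rule poly_time_Cons) (rule poly_time_intros)+
    show "poly_bounded e b" unfolding b_def
      by (intro poly_bounded_mult poly_bounded_Suc poly_bounded_poly poly_bounded_add
        poly_bounded_const poly_bounded_size n)
    show "size (enc_list eb (fold (\<lambda>y s. f x y # s) ys [])) \<le> b x" if "xs x = ys @ zs" for x ys zs
    proof -
      have "size (eb (f x y)) \<le> poly p (size (e x) + n x + 1)" if "y \<in> set ys" for y
      proof -
        have "size (ea y) \<le> n x"
          using size_le_size_enc_list[of y "xs x" ea] that \<open>xs x = ys @ zs\<close> by (simp add: n_def)
        then have "poly p (size (enc_pair e ea (x, y))) \<le> poly p (size (e x) + n x + 1)"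
          by (intro poly_nat_mono) simp
        then show ?thesis using p[of "(x, y)"] by simp
      qed
      then have "size (enc_list eb (map (f x) ys)) \<le> length ys * Suc (poly p (size (e x) + n x + 1))"
        by (rule size_enc_list_map)
      also have "\<dots> \<le> b x" unfolding b_def
        using length_le_size_enc_list[of ys ea] that by (intro mult_le_mono) (auto simp: n_def)
      finally show ?thesis by (simp add: fold)
    qed
  qed
  then have "poly_time e (enc_list eb) (\<lambda>x. rev (map (f x) (xs x)))" by (simp add: fold)
  from poly_time_rev[OF this] show ?thesis by simp
qed

lemma poly_time_concat [poly_time_intros]:
  assumes "poly_time e (enc_list (enc_list ea)) xs"
  shows "poly_time e (enc_list ea) (\<lambda>x. concat (xs x))"
proof -
  have fold: "fold (\<lambda>y s. rev y @ s) yss s = rev (concat yss) @ s" for yss and s :: "'b list"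
    by (induction yss arbitrary: s) auto
  have "poly_time e (enc_list ea) (\<lambda>x. fold (\<lambda>y s. rev y @ s) (xs x) [])"
  proof (rule poly_time_fold[OF assms poly_time_const _ poly_time_size[OF assms]])
    show "poly_time (enc_pair e (enc_pair (enc_list ea) (enc_list ea))) (enc_list ea)
        (\<lambda>z. rev (fst (snd z)) @ snd (snd z))"
      by (rule poly_time_append poly_time_rev poly_time_intros)+
    show "size (enc_list ea (fold (\<lambda>y s. rev y @ s) ys [])) \<le> size (enc_list (enc_list ea) (xs x))"
      if "xs x = ys @ zs" for x ys zs
      unfolding that using size_enc_list_concat[of ea ys] by (simp add: fold)
  qed
  then have "poly_time e (enc_list ea) (\<lambda>x. rev (concat (xs x)))" by (simp add: fold)
  from poly_time_rev[OF this] show ?thesis by simp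
qed

lemma poly_time_length [poly_time_intros]:
  assumes "poly_time e (enc_list ea) xs"
  shows "poly_time e enc_nat (\<lambda>x. length (xs x))"
proof -
  have fold: "fold (\<lambda>_. Suc) ys s = s + length ys" for ys :: "'b list" and s
    by (induction ys arbitrary: s) auto
  have "poly_time e enc_nat (\<lambda>x. fold (\<lambda>_. Suc) (xs x) 0)"
  proof (rule poly_time_fold[OF assms poly_time_const _ poly_time_size[OF assms]])
    show "size (enc_nat (fold (\<lambda>_. Suc) ys 0)) \<le> size (enc_list ea (xs x))"
      if "xs x = ys @ zs" for x ys zs
      unfolding that using length_le_size_enc_list[of ys ea] by (simp add: fold)
  qed (rule poly_time_intros)+
  then show ?thesis by (simp add: fold)
qed

lemma poly_time_add [poly_time_intros]:
  assumes "poly_time e enc_nat m" and "poly_time e enc_nat n"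
  shows "poly_time e enc_nat (\<lambda>x. m x + n x)"
proof -
  from poly_time_length[OF poly_time_append[OF assms[THEN poly_time_replicate_unit]]]
  show ?thesis by simp
qed

text \<open>The product is the length of the concatenation of \<open>m x\<close> lists of
  \<open>n x\<close> units each.\<close>

lemma poly_time_mult [poly_time_intros]:
  assumes "poly_time e enc_nat m" and "poly_time e enc_nat n"
  shows "poly_time e enc_nat (\<lambda>x. m x * n x)"
proof -
  have "poly_time (enc_pair e (\<lambda>_ :: unit. Leaf)) enc_nat (\<lambda>z. n (fst z))"
    by (rule poly_time_comp[OF poly_time_fst[OF poly_time_id] assms(2)])
  then have "poly_time (enc_pair e (\<lambda>_ :: unit. Leaf)) (enc_list (\<lambda>_. Leaf))
      (\<lambda>z. replicate (n (fst z)) ())"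
    by (rule poly_time_replicate_unit)
  note poly_time_map[of e "\<lambda>_. Leaf" _ "\<lambda>x _. replicate (n x) ()", OF this
    poly_time_replicate_unit[OF assms(1)]]
  from poly_time_length[OF poly_time_concat[OF this]]
  show ?thesis by (simp add: length_concat sum_list_replicate)
qed

lemma poly_time_enumerate [poly_time_intros]:
  assumes "poly_time e (enc_list ea) xs"
  shows "poly_time e (enc_list (enc_pair enc_nat ea)) (\<lambda>x. List.enumerate 0 (xs x))"
proof -
  let ?h = "\<lambda>y s. (Suc (fst s), (fst s, y) # snd s)"
  have fold: "fold ?h ys s = (fst s + length ys, rev (List.enumerate (fst s) ys) @ snd s)"
    for ys :: "'b list" and s
    by (induction ys arbitrary: s) auto
  \<comment> \<open>The bound is quadratic because each index is stored in unary.\<close>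
  define b where "b x = (let n = size (enc_list ea (xs x)) in n + (n + n * (n + 1)) + 1)" for x
  have "poly_time e (enc_pair enc_nat (enc_list (enc_pair enc_nat ea)))
      (\<lambda>x. fold ?h (xs x) (0, []))"
  proof (rule poly_time_fold[OF assms poly_time_const, where b = b])
    show "poly_bounded e b" unfolding b_def Let_def
      by (intro poly_bounded_add poly_bounded_mult poly_bounded_const poly_time_size[OF assms])
    show "size (enc_pair enc_nat (enc_list (enc_pair enc_nat ea)) (fold ?h ys (0, []))) \<le> b x"
      if "xs x = ys @ zs" for x ys zs
    proof -
      have "length ys \<le> size (enc_list ea ys)" by (rule length_le_size_enc_list)
      then have n: "length ys \<le> size (enc_list ea (xs x))" "size (enc_list ea ys) \<le> size (enc_list ea (xs x))"
        using that by auto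
      have "length ys * (0 + length ys + 1) \<le> size (enc_list ea (xs x)) * (size (enc_list ea (xs x)) + 1)"
        using n by (intro mult_le_mono) auto
      then show ?thesis
        using size_enc_list_enumerate[of ea 0 ys] n by (simp add: fold b_def Let_def)
    qed
  qed (rule poly_time_intros)+
  then have "poly_time e (enc_list (enc_pair enc_nat ea)) (\<lambda>x. snd (fold ?h (xs x) (0, [])))"
    by (rule poly_time_snd)
  from poly_time_rev[OF this] show ?thesis by (simp add: fold)
qed

lemma poly_time_upt [poly_time_intros]:
  assumes "poly_time e enc_nat n"
  shows "poly_time e (enc_list enc_nat) (\<lambda>x. [0..<n x])"
proof -
  have "poly_time e (enc_list enc_nat) (\<lambda>x. map fst (List.enumerate 0 (replicate (n x) ())))"
    by (rule poly_time_map poly_time_enumerate poly_time_replicate_unit assms poly_time_fst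
      poly_time_snd poly_time_id)+
  then show ?thesis by simp
qed

text \<open>The values of \<open>g\<close> become constants in a nest of \<open>k\<close> zero
  tests, so \<open>g\<close> can be any function, without a way to compute it. This is how a code
  obtained from a counting argument enters a program.\<close>

lemma poly_time_finite_fun:
  assumes "poly_time e enc_nat r"
  shows "poly_time e e' (\<lambda>x. g (min (r x) k))"
  using assms
proof (induction k arbitrary: g r)
  case 0
  show ?case by (simp add: poly_time_const)
next
  case (Suc k)
  have "poly_time e e' (\<lambda>x. if r x \<noteq> 0 then g (Suc (min (r x - 1) k)) else g 0)"
  proof (rule poly_time_if_tree[OF Suc.prems _ _ poly_time_const])
    show "enc_nat (r x) \<noteq> Leaf \<longleftrightarrow> r x \<noteq> 0" for x by (cases "r x") auto
    show "poly_time e e' (\<lambda>x. g (Suc (min (r x - 1) k)))"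
      using Suc.IH[OF poly_time_pred[OF Suc.prems], of "\<lambda>n. g (Suc n)"] .
  qed
  moreover have "(if r x \<noteq> 0 then g (Suc (min (r x - 1) k)) else g 0) = g (min (r x) (Suc k))" for x
    by (cases "r x") auto
  ultimately show ?case by simp
qed

lemma poly_time_div_mod:
  assumes "p > 0" and "poly_time e enc_nat n"
  shows "poly_time e (enc_pair enc_nat enc_nat) (\<lambda>x. (n x div p, n x mod p))"
proof -
  \<comment> \<open>Quotient and remainder are counted up in unary. Capping the remainder with
    \<open>min\<close> gives the test and the update the shape that
    \<open>poly_time_finite_fun\<close> handles; true remainders are below \<open>p\<close>, so the
    cap changes nothing on the states that occur.\<close>
  let ?c = "\<lambda>r. Suc (min r p) = p" and ?d = "\<lambda>r. if Suc (min r p) = p then 0 else Suc (min r p)"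
  let ?h = "\<lambda>_ s. (if ?c (snd s) then Suc (fst s) else fst s, ?d (snd s))"
  have fold: "fold ?h us (k div p, k mod p) = ((k + length us) div p, (k + length us) mod p)"
    for us :: "unit list" and k
  proof (induction us arbitrary: k)
    case (Cons u us)
    have "min (k mod p) p = k mod p" using assms(1) by (simp add: min_absorb1)
    then have "?h u (k div p, k mod p) = (Suc k div p, Suc k mod p)"
      by (auto simp: mod_Suc div_Suc)
    then show ?case using Cons[of "Suc k"] by simp
  qed simp
  have "poly_time e (enc_pair enc_nat enc_nat) (\<lambda>x. fold ?h (replicate (n x) ()) (0, 0))"
  proof (rule poly_time_fold[OF poly_time_replicate_unit[OF assms(2)] poly_time_const,
      where b = "\<lambda>x. n x + n x + 1"])
    let ?e = "enc_pair e (enc_pair (\<lambda>_ :: unit. Leaf) (enc_pair enc_nat enc_nat))"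
    have r: "poly_time ?e enc_nat (\<lambda>z. snd (snd (snd z)))"
      by (rule poly_time_intros)+
    have "poly_time ?e enc_nat (\<lambda>z. if ?c (snd (snd (snd z))) then Suc (fst (snd (snd z)))
        else fst (snd (snd z)))"
      by (rule poly_time_if_bool[OF poly_time_finite_fun[OF r]]) (rule poly_time_intros)+
    moreover have "poly_time ?e enc_nat (\<lambda>z. ?d (snd (snd (snd z))))"
      by (rule poly_time_finite_fun[OF r])
    ultimately show "poly_time ?e (enc_pair enc_nat enc_nat) (\<lambda>z.
        (if ?c (snd (snd (snd z))) then Suc (fst (snd (snd z))) else fst (snd (snd z)),
         ?d (snd (snd (snd z)))))"
      by (rule poly_time_pair)
    show "poly_bounded e (\<lambda>x. n x + n x + 1)"
      using poly_time_size[OF assms(2)]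
      by (intro poly_bounded_add poly_bounded_const) simp_all
    show "size (enc_pair enc_nat enc_nat (fold ?h us (0, 0))) \<le> n x + n x + 1"
      if us: "replicate (n x) () = us @ vs" for x us vs
    proof -
      have "length us + length vs = n x" using arg_cong[OF us, of length] by simp
      moreover have "length us div p \<le> length us" "length us mod p \<le> length us" by simp_all
      ultimately have "length us div p + length us mod p + 1 \<le> n x + n x + 1" by linarith
      moreover have "fold ?h us (0, 0) = (length us div p, length us mod p)" using fold[of us 0] by simp
      ultimately show ?thesis by simp
    qed
  qed
  moreover have "fold ?h (replicate k ()) (0, 0) = (k div p, k mod p)" for k
    using fold[of "replicate k ()" 0] by simp
  ultimately show ?thesis by simp
qed

lemma poly_time_div: "p > 0 \<Longrightarrow> poly_time e enc_nat n \<Longrightarrow> poly_time e enc_nat (\<lambda>x. n x div p)"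
  using poly_time_fst[OF poly_time_div_mod[of p e n]] by simp

lemma poly_time_mod_fun:
  assumes "p > 0" and "poly_time e enc_nat n"
  shows "poly_time e e' (\<lambda>x. g (n x mod p))"
proof -
  have "poly_time e enc_nat (\<lambda>x. n x mod p)"
    using poly_time_snd[OF poly_time_div_mod[OF assms]] by simp
  from poly_time_finite_fun[OF this, of e' g p]
  show ?thesis using assms(1) by (simp add: min_absorb1)
qed

section \<open>Deletion to sparse graphs as a covering problem\<close>

text \<open>These are the predecessor and the successor along the cycle, which differ because its
  length is at least 3.\<close>

lemma cycle_neighbours:
  assumes "is_cycle G vs" and "v \<in> set vs"
  obtains u w where "u \<noteq> w" "u \<in> set vs" "w \<in> set vs" "{u, v} \<in> snd G" "{v, w} \<in> snd G"
proof -
  let ?n = "length vs"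
  obtain i where i: "i < ?n" "v = vs ! i" using assms(2) by (metis in_set_conv_nth)
  have n: "?n \<ge> 3" and dist: "distinct vs"
    and edge: "\<And>i. i < ?n \<Longrightarrow> {vs ! i, vs ! (Suc i mod ?n)} \<in> snd G"
    using assms(1) unfolding is_cycle_def by auto
  define j where "j = (if i = 0 then ?n - 1 else i - 1)"
  have j: "j < ?n" "Suc j mod ?n = i" using i n by (auto simp: j_def)
  have k: "Suc i mod ?n = (if Suc i = ?n then 0 else Suc i)" using i by auto
  then have "Suc i mod ?n < ?n" "j \<noteq> Suc i mod ?n" using i n by (auto simp: j_def)
  then show thesis
    using that[of "vs ! j" "vs ! (Suc i mod ?n)"] edge[OF i(1)] edge[OF j(1)] i j dist
    by (simp add: nth_eq_iff_index_eq)
qed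

section \<open>Triangle-free graphs and star forests\<close>

definition triangle_free :: "'a graph \<Rightarrow> bool" where
  "triangle_free G \<longleftrightarrow> \<not> (\<exists>a b c. {a, b, c} \<subseteq> fst G \<and> a \<noteq> b \<and> b \<noteq> c \<and> a \<noteq> c \<and>
     {a, b} \<in> snd G \<and> {b, c} \<in> snd G \<and> {a, c} \<in> snd G)"

text \<open>\<open>C\<close> contains the centres. As \<open>f\<close> is a function, a vertex
  outside \<open>C\<close> has at most one neighbour. A graph here is an arbitrary pair of sets, so
  that the ends of an edge are vertices has to be demanded explicitly.\<close>

definition star_forest :: "'a graph \<Rightarrow> bool" where
  "star_forest G \<longleftrightarrow> (\<exists>C f. \<forall>e \<in> snd G. \<exists>v. e = {f v, v} \<and> v \<notin> C \<and> f v \<in> C \<and>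
     v \<in> fst G \<and> f v \<in> fst G)"

lemma forest_triangle_free: "forest G \<Longrightarrow> triangle_free G"
proof (unfold triangle_free_def, intro notI, elim exE conjE)
  fix a b c
  assume "forest G" and abc: "{a, b, c} \<subseteq> fst G" "a \<noteq> b" "b \<noteq> c" "a \<noteq> c"
    "{a, b} \<in> snd G" "{b, c} \<in> snd G" "{a, c} \<in> snd G"
  have "{[a, b, c] ! i, [a, b, c] ! (Suc i mod 3)} \<in> snd G" if i: "i < 3" for i
  proof -
    consider "i = 0" | "i = 1" | "i = 2" using i by linarith
    then show ?thesis
    proof cases
      case 1
      then show ?thesis using abc(5) by simp
    next
      case 2
      then show ?thesis using abc(6) by (simp add: numeral_2_eq_2)
    next
      case 3
      then show ?thesis using abc(7) by (simp add: insert_commute)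
    qed
  qed
  then have "is_cycle G [a, b, c]" unfolding is_cycle_def using abc(1-4) by simp
  then show False using \<open>forest G\<close> unfolding forest_def by blast
qed

lemma bipartite_triangle_free: "bipartite G \<Longrightarrow> triangle_free G"
proof -
  assume "bipartite G"
  then obtain A B where AB: "A \<inter> B = {}" "\<forall>e \<in> snd G. \<exists>a \<in> A. \<exists>b \<in> B. e = {a, b}"
    unfolding bipartite_def by (elim exE conjE)
  have key: "u \<in> A \<longleftrightarrow> v \<notin> A" if uv: "{u, v} \<in> snd G" for u v
  proof -
    obtain a b where "a \<in> A" "b \<in> B" "{u, v} = {a, b}" using bspec[OF AB(2) uv] by blast
    then show ?thesis using AB(1) unfolding doubleton_eq_iff by blast
  qed
  have False if "{a, b} \<in> snd G" "{b, c} \<in> snd G" "{a, c} \<in> snd G" for a b c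
    using key[OF that(1)] key[OF that(2)] key[OF that(3)] by blast
  then show ?thesis unfolding triangle_free_def by blast
qed

text \<open>Of two consecutive vertices of a cycle one lies outside \<open>C\<close>. It would need
  two distinct neighbours on the cycle, but both are its centre.\<close>

lemma star_forest_forest:
  assumes "star_forest G"
  shows "forest G"
  unfolding forest_def
proof
  assume "\<exists>vs. is_cycle G vs"
  then obtain vs where vs: "is_cycle G vs" by blast
  obtain C f where "\<forall>e \<in> snd G. \<exists>v. e = {f v, v} \<and> v \<notin> C \<and> f v \<in> C \<and>
     v \<in> fst G \<and> f v \<in> fst G" using assms unfolding star_forest_def by (elim exE)
  then have star: "\<exists>v. e = {f v, v} \<and> v \<notin> C \<and> f v \<in> C" if "e \<in> snd G" for e
    using that by blast
  have leaf: "u = f v" if "{u, v} \<in> snd G" "v \<notin> C" for u v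
    using star[OF that(1)] that(2) by (auto simp: doubleton_eq_iff)
  have "vs \<noteq> []" using vs by (auto simp: is_cycle_def)
  then have "hd vs \<in> set vs" by simp
  with vs obtain u where u: "u \<in> set vs" "{u, hd vs} \<in> snd G" by (rule cycle_neighbours)
  obtain v where v: "v \<in> set vs" "v \<notin> C"
    using star[OF u(2)] u(1) \<open>hd vs \<in> set vs\<close> by (auto simp: doubleton_eq_iff)
  obtain a b where "a \<noteq> b" "{a, v} \<in> snd G" "{v, b} \<in> snd G"
    using vs v(1) by (rule cycle_neighbours)
  then show False using leaf[of a v] leaf[of b v] v(2) by (simp add: insert_commute)
qed

lemma star_forest_bipartite:
  assumes "star_forest G"
  shows "bipartite G"
proof -
  obtain C f where star: "\<forall>e \<in> snd G. \<exists>v. e = {f v, v} \<and> v \<notin> C \<and> f v \<in> C \<and>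
     v \<in> fst G \<and> f v \<in> fst G" using assms unfolding star_forest_def by (elim exE)
  show ?thesis unfolding bipartite_def
  proof (intro exI conjI ballI)
    show "(fst G \<inter> C) \<union> (fst G - C) = fst G" "(fst G \<inter> C) \<inter> (fst G - C) = {}" by auto
    show "\<exists>a \<in> fst G \<inter> C. \<exists>b \<in> fst G - C. e = {a, b}" if "e \<in> snd G" for e
      using bspec[OF star that] by blast
  qed
qed

section \<open>The gadgets and their graph\<close>

datatype vertex = Base nat | Hub nat nat | Link nat nat nat

text \<open>Hubs have one index more than \<open>L\<close> has terms; the last hub is in the clique
  but in no triangle with a link. An edge between a hub and an element \<open>t\<close> would be
  harmless in a forest or a bipartite graph, so a link closes it to a triangle. Each link is private
  to one hub and one element. The numbering is a parameter, so that the graph argument only sees the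
  roles recorded in type \<open>vertex\<close>.\<close>

definition gadget_edges ::
    "(nat \<Rightarrow> nat \<Rightarrow> nat) \<Rightarrow> (nat \<Rightarrow> nat \<Rightarrow> nat \<Rightarrow> nat) \<Rightarrow> nat \<Rightarrow> nat list list \<Rightarrow> (nat \<times> nat) list" where
  "gadget_edges hub link g L =
     concat (map (\<lambda>i. map (\<lambda>j. (hub g i, hub g j)) [0..<i]) [0..<Suc (length L)]) @
     concat (map (\<lambda>a. concat (map (\<lambda>t. [(hub g (fst a), t), (hub g (fst a), link g (fst a) t),
       (link g (fst a) t, t)]) (snd a))) (List.enumerate 0 L))"

definition constraint_edges ::
    "(nat \<Rightarrow> nat \<Rightarrow> nat) \<Rightarrow> (nat \<Rightarrow> nat \<Rightarrow> nat \<Rightarrow> nat) \<Rightarrow> nat list list list \<Rightarrow> (nat \<times> nat) list" where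
  "constraint_edges hub link D =
     concat (map (\<lambda>a. gadget_edges hub link (fst a) (snd a)) (List.enumerate 0 D))"

text \<open>A constraint is a list of terms, and a set satisfies it if it includes one of the terms.
  The clique of the hubs of a constraint with \<open>r\<close> terms has \<open>r + 1\<close> vertices, of which a
  triangle-free graph keeps at most two. So at least \<open>r - 1\<close> vertices are deleted from each gadget,
  and if it is no more than that, then a hub other than the spare one with index \<open>r\<close> is kept, along
  with all links, and the triangles through this hub force the deletion of its term. Since the
  budget allows only \<open>h\<close> further deletions and each constraint has more than \<open>h\<close> gadgets, all
  constraints get satisfied.\<close>

locale constraint_graph =
  fixes N h V :: nat and D :: "nat list list list"
    and hub :: "nat \<Rightarrow> nat \<Rightarrow> nat" and link :: "nat \<Rightarrow> nat \<Rightarrow> nat \<Rightarrow> nat" and dec :: "nat \<Rightarrow> vertex"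
  assumes nonempty: "g < length D \<Longrightarrow> D ! g \<noteq> []"
    and term_less: "g < length D \<Longrightarrow> i < length (D ! g) \<Longrightarrow> t \<in> set (D ! g ! i) \<Longrightarrow> t < N"
    and many: "g < length D \<Longrightarrow> h < card {g'. g' < length D \<and> D ! g' = D ! g}"
    and dec_base: "t < N \<Longrightarrow> dec t = Base t"
    and dec_hub: "g < length D \<Longrightarrow> i \<le> length (D ! g) \<Longrightarrow> dec (hub g i) = Hub g i"
    and dec_link: "g < length D \<Longrightarrow> i < length (D ! g) \<Longrightarrow> t \<in> set (D ! g ! i) \<Longrightarrow>
      dec (link g i t) = Link g i t"
    and N_le: "N \<le> V"
    and hub_less: "g < length D \<Longrightarrow> i \<le> length (D ! g) \<Longrightarrow> hub g i < V"
    and link_less: "g < length D \<Longrightarrow> i < length (D ! g) \<Longrightarrow> t \<in> set (D ! g ! i) \<Longrightarrow> link g i t < V"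
begin

abbreviation "input \<equiv> (V, constraint_edges hub link D)"
abbreviation "G \<equiv> graph_of input"

definition "budget = h + (\<Sum>g < length D. length (D ! g) - 1)"

lemma set_constraint_edges:
  "set (constraint_edges hub link D) = (\<Union>g < length D.
    (\<Union>i \<le> length (D ! g). \<Union>j < i. {(hub g i, hub g j)}) \<union>
    (\<Union>i < length (D ! g). \<Union>t \<in> set (D ! g ! i).
      {(hub g i, t), (hub g i, link g i t), (link g i t, t)}))"
proof -
  have enum: "set (List.enumerate 0 xs) = (\<lambda>i. (i, xs ! i)) ` {..<length xs}" for xs :: "'a list"
    by (auto simp: in_set_enumerate_eq image_def)
  have "set (gadget_edges hub link g L) = (\<Union>i \<le> length L. \<Union>j < i. {(hub g i, hub g j)}) \<union>
    (\<Union>i < length L. \<Union>t \<in> set (L ! i). {(hub g i, t), (hub g i, link g i t), (link g i t, t)})"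
    for g L
    unfolding gadget_edges_def set_append
  proof (rule arg_cong2[where f = "(\<union>)"])
    have "set [0..<Suc (length L)] = {..length L}" by auto
    then show "set (concat (map (\<lambda>i. map (\<lambda>j. (hub g i, hub g j)) [0..<i]) [0..<Suc (length L)])) =
      (\<Union>i \<le> length L. \<Union>j < i. {(hub g i, hub g j)})"
      unfolding set_concat set_map by (simp add: atLeast0LessThan UNION_singleton_eq_range)
  qed (simp add: enum)
  then show ?thesis unfolding constraint_edges_def by (simp add: enum)
qed

lemma edge_cases [consumes 1, case_names clique arm outer inner]:
  assumes "e \<in> snd G"
  obtains
    g i j where "g < length D" "i \<le> length (D ! g)" "j < i" "e = {hub g i, hub g j}"
  | g i t where "g < length D" "i < length (D ! g)" "t \<in> set (D ! g ! i)" "e = {hub g i, t}"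
  | g i t where "g < length D" "i < length (D ! g)" "t \<in> set (D ! g ! i)" "e = {hub g i, link g i t}"
  | g i t where "g < length D" "i < length (D ! g)" "t \<in> set (D ! g ! i)" "e = {link g i t, t}"
proof -
  obtain u v where "(u, v) \<in> set (constraint_edges hub link D)" "e = {u, v}"
    using assms by (auto simp: graph_of_def)
  from this(1)[unfolded set_constraint_edges] show thesis
  proof (elim UnE UN_E)
    fix g i j assume "g \<in> {..<length D}" "i \<in> {..length (D ! g)}" "j \<in> {..<i}"
      "(u, v) \<in> {(hub g i, hub g j)}"
    then show thesis using that(1)[of g i j] \<open>e = {u, v}\<close> by simp
  next
    fix g i t
    assume "g \<in> {..<length D}" "i \<in> {..<length (D ! g)}" "t \<in> set (D ! g ! i)"
      and "(u, v) \<in> {(hub g i, t), (hub g i, link g i t), (link g i t, t)}"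
    then show thesis using that(2-4)[of g i t] \<open>e = {u, v}\<close>
      by (elim insertE) simp_all
  qed
qed

lemma clique_edge: "g < length D \<Longrightarrow> i \<le> length (D ! g) \<Longrightarrow> j \<le> length (D ! g) \<Longrightarrow> i \<noteq> j \<Longrightarrow>
    {hub g i, hub g j} \<in> snd G"
proof (induction i j rule: linorder_wlog)
  case (le a b)
  then have "a < b" by simp
  with le have "(hub g b, hub g a) \<in> set (constraint_edges hub link D)"
    unfolding set_constraint_edges by blast
  then show ?case by (auto simp: graph_of_def)
next
  case (sym a b)
  then show ?case by (simp add: insert_commute)
qed

lemma triangle_edges:
  assumes "g < length D" "i < length (D ! g)" "t \<in> set (D ! g ! i)"
  shows "{hub g i, t} \<in> snd G" "{hub g i, link g i t} \<in> snd G" "{link g i t, t} \<in> snd G"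
proof -
  have "(hub g i, t) \<in> set (constraint_edges hub link D)"
    "(hub g i, link g i t) \<in> set (constraint_edges hub link D)"
    "(link g i t, t) \<in> set (constraint_edges hub link D)"
    unfolding set_constraint_edges using assms by blast+
  then show "{hub g i, t} \<in> snd G" "{hub g i, link g i t} \<in> snd G" "{link g i t, t} \<in> snd G"
    by (auto simp: graph_of_def)
qed

lemma dec_term: "g < length D \<Longrightarrow> i < length (D ! g) \<Longrightarrow> t \<in> set (D ! g ! i) \<Longrightarrow> dec t = Base t"
  using dec_base term_less by blast

lemma triangle_distinct:
  assumes "g < length D" "i < length (D ! g)" "t \<in> set (D ! g ! i)"
  shows "hub g i \<noteq> t" "hub g i \<noteq> link g i t" "link g i t \<noteq> t"
proof -
  have "dec (hub g i) = Hub g i" "dec (link g i t) = Link g i t" "dec t = Base t"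
    using assms dec_hub[of g i] dec_link dec_term by simp_all
  then show "hub g i \<noteq> t" "hub g i \<noteq> link g i t" "link g i t \<noteq> t"
    by (metis vertex.distinct)+
qed

lemma valid_input: "valid_graph_input input"
proof -
  have "u < V \<and> v < V \<and> u \<noteq> v" if "(u, v) \<in> set (constraint_edges hub link D)" for u v
  proof -
    show ?thesis using that unfolding set_constraint_edges
    proof (elim UnE UN_E)
      fix g i j assume a: "g \<in> {..<length D}" "i \<in> {..length (D ! g)}" "j \<in> {..<i}"
        "(u, v) \<in> {(hub g i, hub g j)}"
      then have "dec u \<noteq> dec v" by (simp add: dec_hub)
      then have "u \<noteq> v" by blast
      then show ?thesis using a by (simp add: hub_less)
    next
      fix g i t
      assume a: "g \<in> {..<length D}" "i \<in> {..<length (D ! g)}" "t \<in> set (D ! g ! i)"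
        and uv: "(u, v) \<in> {(hub g i, t), (hub g i, link g i t), (link g i t, t)}"
      then have "t < V" using term_less N_le by force
      then show ?thesis using a uv triangle_distinct[of g i t] by (auto simp: hub_less link_less)
    qed
  qed
  then show ?thesis unfolding valid_graph_input_def by auto
qed

text \<open>Without the base vertices a link is adjacent to its hub only and different gadgets are
  disconnected: what remains are disjoint cliques with pendant vertices. A cycle avoids pendant
  vertices and so stays in one clique, where its positions 0 and 2 give a chord as soon as the
  length is at least 4.\<close>

lemma chordal_deletion_set_base: "chordal_deletion_set G {..<N}"
  unfolding chordal_deletion_set_def
proof
  show "{..<N} \<subseteq> fst G" using N_le by (auto simp: graph_of_def)
  let ?H = "delete_vertices G {..<N}"
  have edge: "(\<exists>g i j. g < length D \<and> i \<le> length (D ! g) \<and> j \<le> length (D ! g) \<and>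
      u = hub g i \<and> v = hub g j) \<or>
    (\<exists>g i t. g < length D \<and> i \<le> length (D ! g) \<and> u = hub g i \<and> dec v = Link g i t) \<or>
    (\<exists>g i t. g < length D \<and> i \<le> length (D ! g) \<and> v = hub g i \<and> dec u = Link g i t)"
    if "{u, v} \<in> snd ?H" for u v
  proof -
    have "{u, v} \<in> snd G" and out: "u \<ge> N" "v \<ge> N"
      using that by (auto simp: delete_vertices_def)
    from this(1) show ?thesis
    proof (cases rule: edge_cases)
      case (clique g i j)
      then have "j \<le> length (D ! g)" "u = hub g i \<and> v = hub g j \<or> u = hub g j \<and> v = hub g i"
        by (simp_all add: doubleton_eq_iff)
      then show ?thesis using clique(1,2) by blast
    next
      case (inner g i t)
      then have "t = u \<or> t = v" unfolding doubleton_eq_iff by blast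
      then show ?thesis using out term_less[OF inner(1-3)] by linarith
    next
      case (arm g i t)
      then have "t = u \<or> t = v" unfolding doubleton_eq_iff by blast
      then show ?thesis using out term_less[OF arm(1-3)] by linarith
    next
      case (outer g i t)
      then have "u = hub g i \<and> dec v = Link g i t \<or> v = hub g i \<and> dec u = Link g i t"
        using dec_link by (auto simp: doubleton_eq_iff)
      then show ?thesis using outer(1,2) less_imp_le by blast
    qed
  qed
  show "chordal ?H"
    unfolding chordal_def
  proof (intro allI impI, elim conjE)
    fix vs assume vs: "is_cycle ?H vs" "length vs \<ge> 4"
    \<comment> \<open>Otherwise \<open>v\<close> is a link. Its decoding determines its hub, so its
      two distinct neighbours on the cycle would coincide.\<close>
    have hubs: "\<exists>g i. g < length D \<and> i \<le> length (D ! g) \<and> v = hub g i" if v: "v \<in> set vs" for v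
    proof (rule ccontr)
      assume no: "\<not> ?thesis"
      obtain u w where uw: "u \<noteq> w" "{u, v} \<in> snd ?H" "{v, w} \<in> snd ?H"
        using vs(1) v by (rule cycle_neighbours)
      from edge[OF uw(2)] no obtain g i t where 1: "u = hub g i" "dec v = Link g i t" by blast
      from edge[OF uw(3)] no obtain g' i' t' where 2: "w = hub g' i'" "dec v = Link g' i' t'" by blast
      from 1 2 uw(1) show False by simp
    qed
    have same: "\<exists>g i j. g < length D \<and> i \<le> length (D ! g) \<and> j \<le> length (D ! g) \<and>
      u = hub g i \<and> v = hub g j" if "{u, v} \<in> snd ?H" "u \<in> set vs" "v \<in> set vs" for u v
    proof -
      have "dec u \<noteq> Link g i t" "dec v \<noteq> Link g i t" for g i t
        using hubs[OF that(2)] hubs[OF that(3)] dec_hub by force+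
      then show ?thesis using edge[OF that(1)] by blast
    qed
    have in_vs: "vs ! 0 \<in> set vs" "vs ! 1 \<in> set vs" "vs ! 2 \<in> set vs"
      by (rule nth_mem, use vs(2) in linarith)+
    have ring: "{vs ! i, vs ! (Suc i mod length vs)} \<in> snd ?H" if "i < length vs" for i
      using vs(1) that unfolding is_cycle_def by blast
    have cyc: "{vs ! 0, vs ! 1} \<in> snd ?H" "{vs ! 1, vs ! 2} \<in> snd ?H"
      using ring[of 0] ring[of 1] vs(2)
      by (simp_all add: numeral_2_eq_2 flip: length_greater_0_conv del: length_greater_0_conv)
    from same[OF cyc(1) in_vs(1,2)] obtain g i j where 1: "g < length D" "i \<le> length (D ! g)"
      "j \<le> length (D ! g)" "vs ! 0 = hub g i" "vs ! 1 = hub g j" by blast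
    from same[OF cyc(2) in_vs(2,3)] obtain g' i' j' where 2: "g' < length D" "i' \<le> length (D ! g')"
      "j' \<le> length (D ! g')" "vs ! 1 = hub g' i'" "vs ! 2 = hub g' j'" by blast
    have "Hub g j = dec (vs ! 1)" unfolding 1(5) by (rule dec_hub[OF 1(1,3), symmetric])
    also have "\<dots> = Hub g' i'" unfolding 2(4) by (rule dec_hub[OF 2(1,2)])
    finally have "g' = g" by simp
    have "distinct vs" using vs(1) unfolding is_cycle_def by blast
    then have "vs ! 0 \<noteq> vs ! 2" using vs(2) by (subst nth_eq_iff_index_eq) auto
    then have "{vs ! 0, vs ! 2} \<in> snd G"
      using clique_edge[of g i j'] 1 2 \<open>g' = g\<close> by auto
    moreover have "{vs ! 0, vs ! 2} \<inter> {..<N} = {}"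
      using in_vs vs(1) by (auto simp: is_cycle_def delete_vertices_def)
    ultimately have "{vs ! 0, vs ! 2} \<in> snd ?H" by (simp add: delete_vertices_def)
    then show "has_chord ?H vs" unfolding has_chord_def using vs(2)
      by (intro exI[of _ 0] conjI exI[of _ 2]) auto
  qed
qed

definition "satisfies H \<longleftrightarrow> (\<forall>L \<in> set D. \<exists>A \<in> set L. set A \<subseteq> H)"

lemma deletion_if_satisfies:
  assumes "satisfies H" and "H \<subseteq> {..<N}" and "card H \<le> h"
    and star: "\<And>G :: nat graph. star_forest G \<Longrightarrow> \<Pi> G"
  shows "has_deletion_set \<Pi> G budget"
proof -
  have "\<exists>i < length (D ! g). set (D ! g ! i) \<subseteq> H" if "g < length D" for g
    using assms(1) that unfolding satisfies_def by (metis in_set_conv_nth)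
  then obtain sel where sel: "\<And>g. g < length D \<Longrightarrow> sel g < length (D ! g)"
    "\<And>g. g < length D \<Longrightarrow> set (D ! g ! sel g) \<subseteq> H" by metis
  \<comment> \<open>In each gadget the hub of a satisfied term is kept. So is the spare hub, whose
    index is outside this range, and thus \<open>r - 1\<close> of the \<open>r + 1\<close> hubs are
    deleted.\<close>
  define Y where "Y g = hub g ` ({..<length (D ! g)} - {sel g})" for g
  define X where "X = H \<union> (\<Union>g < length D. Y g)"
  have "finite H" using assms(2) finite_subset by blast
  have "card X \<le> card H + card (\<Union>g < length D. Y g)" unfolding X_def by (rule card_Un_le)
  also have "card (\<Union>g < length D. Y g) \<le> (\<Sum>g < length D. card (Y g))"
    by (rule card_UN_le) simp
  also have "\<dots> \<le> (\<Sum>g < length D. length (D ! g) - 1)"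
  proof (rule sum_mono)
    fix g assume "g \<in> {..<length D}"
    have "card (Y g) \<le> card ({..<length (D ! g)} - {sel g})" unfolding Y_def by (rule card_image_le) simp
    also have "\<dots> = length (D ! g) - 1" using sel(1)[of g] \<open>g \<in> _\<close> by simp
    finally show "card (Y g) \<le> length (D ! g) - 1" .
  qed
  finally have "card X \<le> budget" using assms(3) unfolding budget_def by simp
  have "X \<subseteq> fst G"
    using assms(2) N_le hub_less by (fastforce simp: X_def Y_def graph_of_def)
  have hub_X: "hub g i \<in> X" if "g < length D" "i < length (D ! g)" "i \<noteq> sel g" for g i
    using that unfolding X_def Y_def by blast
  have base_X: "t \<in> X" if "g < length D" "t \<in> set (D ! g ! sel g)" for g t
    using sel(2)[OF that(1)] that(2) unfolding X_def by blast
  let ?H = "delete_vertices G X"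
  \<comment> \<open>Two kinds of stars remain. The selected hub is the centre for the spare hub and
    for the links of the selected term, whose base elements are deleted. A kept base vertex is the
    centre for its links in terms that are not selected, whose hubs are deleted.\<close>
  define f where "f v = (case dec v of Base t \<Rightarrow> v | Hub g i \<Rightarrow> hub g (sel g)
    | Link g i t \<Rightarrow> if i = sel g then hub g i else t)" for v
  define C where "C = {v. case dec v of Base t \<Rightarrow> True | Hub g i \<Rightarrow> i < length (D ! g)
    | Link g i t \<Rightarrow> False}"
  have "\<exists>v. e = {f v, v} \<and> v \<notin> C \<and> f v \<in> C \<and> v \<in> fst ?H \<and> f v \<in> fst ?H" if "e \<in> snd ?H" for e
  proof -
    have "e \<in> snd G" and out: "\<And>v. v \<in> e \<Longrightarrow> v \<notin> X"
      using that by (auto simp: delete_vertices_def)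
    from this(1) show ?thesis
    proof (cases rule: edge_cases)
      case (clique g i j)
      then have "j = sel g" "i = length (D ! g)"
        using hub_X[of g j] hub_X[of g i] out by (auto simp: nat_less_le)
      then show ?thesis using clique out sel(1)[of g] hub_less
        by (intro exI[of _ "hub g i"])
          (auto simp: f_def C_def dec_hub graph_of_def delete_vertices_def)
    next
      case (arm g i t)
      then have "i = sel g" using hub_X[of g i] out by auto
      then show ?thesis using base_X[of g t] arm out by auto
    next
      case (outer g i t)
      then have "i = sel g" using hub_X[of g i] out by auto
      then show ?thesis using outer out hub_less link_less
        by (intro exI[of _ "link g i t"])
          (auto simp: f_def C_def dec_hub dec_link graph_of_def delete_vertices_def)
    next
      case (inner g i t)
      then have "i \<noteq> sel g" using base_X[of g t] out by auto
      moreover have "t < V" using term_less N_le inner by force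
      ultimately show ?thesis using inner out link_less
        by (intro exI[of _ "link g i t"])
          (auto simp: f_def C_def dec_term dec_link graph_of_def delete_vertices_def)
    qed
  qed
  then have "star_forest ?H" unfolding star_forest_def by blast
  with \<open>X \<subseteq> fst G\<close> \<open>card X \<le> budget\<close> show ?thesis
    unfolding has_deletion_set_def using star by blast
qed

lemma satisfies_if_deletion:
  assumes "has_deletion_set \<Pi> G budget" and "\<And>G :: nat graph. \<Pi> G \<Longrightarrow> triangle_free G"
  shows "\<exists>H \<subseteq> {..<N}. card H \<le> h \<and> satisfies H"
proof -
  obtain X where X: "X \<subseteq> fst G" "card X \<le> budget" "\<Pi> (delete_vertices G X)"
    using assms(1) unfolding has_deletion_set_def by blast
  note free = assms(2)[OF X(3)]
  have no_triangle: False
    if "a < V" "b < V" "c < V" "a \<notin> X" "b \<notin> X" "c \<notin> X" "a \<noteq> b" "b \<noteq> c" "a \<noteq> c"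
      "{a, b} \<in> snd G" "{b, c} \<in> snd G" "{a, c} \<in> snd G" for a b c
  proof -
    let ?H = "delete_vertices G X"
    have "{a, b} \<in> snd ?H" "{b, c} \<in> snd ?H" "{a, c} \<in> snd ?H"
      using that by (simp_all add: delete_vertices_def)
    moreover have "{a, b, c} \<subseteq> fst ?H"
      using that by (simp add: delete_vertices_def graph_of_def)
    ultimately show False using free that(7-9) unfolding triangle_free_def by blast
  qed
  have "finite X" by (rule finite_subset[OF X(1)]) (simp add: graph_of_def)
  define H where "H = X \<inter> {..<N}"
  define Y where "Y g = hub g ` {..length (D ! g)}" for g
  define Z where "Z g = (\<Union>i < length (D ! g). link g i ` set (D ! g ! i))" for g
  define c where "c g = card (X \<inter> (Y g \<union> Z g))" for g
  have fin: "finite (Y g)" "finite (Z g)" for g unfolding Y_def Z_def by auto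
  have dec_Y: "\<exists>i. dec v = Hub g i" if "v \<in> Y g" "g < length D" for v g
    using that dec_hub unfolding Y_def by blast
  have dec_Z: "\<exists>i t. dec v = Link g i t" if "v \<in> Z g" "g < length D" for v g
    using that dec_link unfolding Z_def by blast
  have disj: "Y g \<inter> Z g = {}" if "g < length D" for g
  proof -
    have False if v: "v \<in> Y g" "v \<in> Z g" for v
      using dec_Y[OF v(1) \<open>g < length D\<close>] dec_Z[OF v(2) \<open>g < length D\<close>] by auto
    then show ?thesis by blast
  qed
  have hub_inj: "inj_on (hub g) {..length (D ! g)}" if "g < length D" for g
  proof (rule inj_onI)
    fix i j assume ij: "i \<in> {..length (D ! g)}" "j \<in> {..length (D ! g)}" "hub g i = hub g j"
    have "dec (hub g i) = Hub g i" using ij(1) dec_hub[OF that] by simp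
    moreover have "dec (hub g j) = Hub g j" using ij(2) dec_hub[OF that] by simp
    ultimately show "i = j" unfolding ij(3) by simp
  qed
  have kept: "card (Y g - X) \<le> 2" if g: "g < length D" for g
  proof (rule ccontr)
    assume "\<not> ?thesis"
    then have "card (Y g - X) \<ge> 3" by simp
    then obtain T where T: "T \<subseteq> Y g - X" "card T = 3" by (meson obtain_subset_with_card_n)
    then obtain a b c where abc: "T = {a, b, c}" "a \<noteq> b" "b \<noteq> c" "a \<noteq> c"
      by (auto simp: card_3_iff)
    then obtain i j k where ijk: "i \<le> length (D ! g)" "j \<le> length (D ! g)" "k \<le> length (D ! g)"
      "a = hub g i" "b = hub g j" "c = hub g k" using T(1) unfolding Y_def by auto
    then have "{a, b} \<in> snd G" "{b, c} \<in> snd G" "{a, c} \<in> snd G" "a < V" "b < V" "c < V"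
      using clique_edge[OF g] hub_less[OF g] abc(2-4) by metis+
    then show False using no_triangle[of a b c] abc T(1) by blast
  qed
  have card_Y: "card (Y g) = length (D ! g) + 1" if "g < length D" for g
    using card_image[OF hub_inj[OF that]] unfolding Y_def by simp
  have split: "card (X \<inter> Y g) + card (Y g - X) = length (D ! g) + 1" if "g < length D" for g
  proof -
    have "card (X \<inter> Y g \<union> (Y g - X)) = card (X \<inter> Y g) + card (Y g - X)"
      using fin(1)[of g] by (intro card_Un_disjoint) auto
    moreover have "X \<inter> Y g \<union> (Y g - X) = Y g" by blast
    ultimately show ?thesis using card_Y[OF that] by simp
  qed
  have c_eq: "c g = card (X \<inter> Y g) + card (X \<inter> Z g)" if "g < length D" for g
    unfolding c_def Int_Un_distrib
    using disj[OF that] fin[of g] by (intro card_Un_disjoint) auto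
  have c_ge: "length (D ! g) - 1 \<le> c g" if "g < length D" for g
    using split[OF that] kept[OF that] c_eq[OF that] by linarith
  \<comment> \<open>At most two hubs are kept, so \<open>r - 1\<close> deletions are all spent on
    hubs: no link is deleted and exactly two hubs are kept. One of them is not the spare hub, and
    each of its triangles can only be destroyed at the base vertex.\<close>
  have tight: "\<exists>A \<in> set (D ! g). set A \<subseteq> H" if g: "g < length D" and "c g \<le> length (D ! g) - 1" for g
  proof -
    have pos: "length (D ! g) > 0" using nonempty[OF g] by simp
    then have "card (X \<inter> Z g) = 0" "card (Y g - X) \<ge> 2"
      using that(2) split[OF g] kept[OF g] c_eq[OF g] by linarith+
    then have Z: "X \<inter> Z g = {}" using fin by simp
    have "\<not> Y g - X \<subseteq> {hub g (length (D ! g))}"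
      using \<open>card (Y g - X) \<ge> 2\<close> card_mono[of "{hub g (length (D ! g))}" "Y g - X"] by auto
    then obtain v where v: "v \<in> Y g" "v \<notin> X" "v \<noteq> hub g (length (D ! g))" by blast
    then obtain k where k: "k \<le> length (D ! g)" "v = hub g k" unfolding Y_def by blast
    then have "k \<noteq> length (D ! g)" using v(3) by blast
    with k v(2) obtain i where i: "i < length (D ! g)" "hub g i \<notin> X" by (auto simp: le_less)
    have "t \<in> H" if t: "t \<in> set (D ! g ! i)" for t
    proof (rule ccontr)
      assume "t \<notin> H"
      then have "t \<notin> X" "t < V" using term_less[OF g i(1) t] N_le by (auto simp: H_def)
      moreover have "link g i t \<notin> X" using Z i(1) t unfolding Z_def by blast
      ultimately show False
        using triangle_distinct[OF g i(1) t] no_triangle[of "hub g i" t "link g i t"] i(2) triangle_edges[OF g i(1) t]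
          hub_less[OF g, of i] link_less[OF g i(1) t] i(1) by (simp add: insert_commute)
    qed
    then show ?thesis using i(1) nth_mem by blast
  qed
  have total: "card H + (\<Sum>g < length D. c g) \<le> budget"
  proof -
    have "card (\<Union>g < length D. X \<inter> (Y g \<union> Z g)) = (\<Sum>g < length D. c g)"
      unfolding c_def
    proof (rule card_UN_disjoint)
      have "u \<noteq> v" if "g < length D" "g' < length D" "g \<noteq> g'" "u \<in> Y g \<union> Z g" "v \<in> Y g' \<union> Z g'"
        for g g' u v
        using that dec_Y[of u g] dec_Z[of u g] dec_Y[of v g'] dec_Z[of v g'] by auto
      then show "\<forall>g \<in> {..<length D}. \<forall>g' \<in> {..<length D}. g \<noteq> g' \<longrightarrow>
        X \<inter> (Y g \<union> Z g) \<inter> (X \<inter> (Y g' \<union> Z g')) = {}" by blast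
    qed (use \<open>finite X\<close> in auto)
    moreover have "H \<inter> (\<Union>g < length D. X \<inter> (Y g \<union> Z g)) = {}"
      using dec_Y dec_Z dec_base unfolding H_def by fastforce
    then have "card (H \<union> (\<Union>g < length D. X \<inter> (Y g \<union> Z g))) =
        card H + card (\<Union>g < length D. X \<inter> (Y g \<union> Z g))"
      using \<open>finite X\<close> by (intro card_Un_disjoint) (auto simp: H_def)
    moreover have "card (H \<union> (\<Union>g < length D. X \<inter> (Y g \<union> Z g))) \<le> card X"
      using \<open>finite X\<close> by (intro card_mono) (auto simp: H_def)
    ultimately show ?thesis using X(2) by linarith
  qed
  \<comment> \<open>The deletions in a gadget beyond the unavoidable ones. By \<open>c_ge\<close>
    the subtraction is not truncated. A gadget of a violated constraint has excess at least 1, and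
    so do all its copies, which are more than \<open>h\<close>.\<close>
  define ex where "ex g = c g - (length (D ! g) - 1)" for g
  have "(\<Sum>g < length D. c g) = (\<Sum>g < length D. length (D ! g) - 1) + (\<Sum>g < length D. ex g)"
    unfolding ex_def sum.distrib[symmetric] using c_ge by (intro sum.cong) auto
  then have excess: "card H + (\<Sum>g < length D. ex g) \<le> h"
    using total unfolding budget_def by linarith
  have sat: "\<exists>A \<in> set (D ! g). set A \<subseteq> H" if g: "g < length D" for g
  proof (rule ccontr)
    let ?S = "{g'. g' < length D \<and> D ! g' = D ! g}"
    assume no: "\<not> ?thesis"
    have "card ?S = (\<Sum>g' \<in> ?S. 1)" by simp
    also have "\<dots> \<le> (\<Sum>g' \<in> ?S. ex g')"
    proof (rule sum_mono)
      fix g' assume "g' \<in> ?S"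
      then show "1 \<le> ex g'" using tight[of g'] no by (force simp: ex_def)
    qed
    also have "\<dots> \<le> (\<Sum>g < length D. ex g)" by (rule sum_mono2) auto
    finally show False using many[OF g] excess by linarith
  qed
  have "satisfies H" unfolding satisfies_def
  proof
    fix L assume "L \<in> set D"
    then obtain g where "g < length D" "L = D ! g" unfolding in_set_conv_nth by blast
    then show "\<exists>A \<in> set L. set A \<subseteq> H" by (simp only: sat)
  qed
  moreover have "card H \<le> h" using excess by linarith
  moreover have "H \<subseteq> {..<N}" unfolding H_def by (rule Int_lower2)
  ultimately have "H \<subseteq> {..<N} \<and> card H \<le> h \<and> satisfies H" by (intro conjI)
  then show ?thesis by (rule exI)
qed

end

section \<open>Numbering the vertices\<close>

definition hub_vertex :: "nat \<Rightarrow> nat \<Rightarrow> nat \<Rightarrow> nat \<Rightarrow> nat" where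
  "hub_vertex N R g i = Suc N * Suc (g * Suc R + i) + N"

definition link_vertex :: "nat \<Rightarrow> nat \<Rightarrow> nat \<Rightarrow> nat \<Rightarrow> nat \<Rightarrow> nat" where
  "link_vertex N R g i t = Suc N * Suc (g * Suc R + i) + t"

text \<open>Inverts the numbering, which consists of rows of \<open>N + 1\<close> numbers. Row 0
  holds the base vertices. Each pair \<open>(g, i)\<close> with \<open>i \<le> R\<close> has a later
  row of its own, in which offset \<open>t < N\<close> is the link to \<open>t\<close> and the last
  offset \<open>N\<close> is the hub.\<close>

definition decode_vertex :: "nat \<Rightarrow> nat \<Rightarrow> nat \<Rightarrow> vertex" where
  "decode_vertex N R v = (let q = v div Suc N; r = v mod Suc N; g = (q - 1) div Suc R; i = (q - 1) mod Suc R in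
     if q = 0 then Base v else if r = N then Hub g i else Link g i r)"

lemma div_mod_Suc: "t < Suc N \<Longrightarrow> (Suc N * k + t) div Suc N = k \<and> (Suc N * k + t) mod Suc N = t"
  by (metis add.commute div_mult_self4 div_less add_0 mod_mult_self4 mod_less mult.commute Zero_not_Suc)

lemma decode_base: "t < N \<Longrightarrow> decode_vertex N R t = Base t"
  by (simp add: decode_vertex_def)

lemma row_decode: "i \<le> R \<Longrightarrow> (g * Suc R + i) div Suc R = g \<and> (g * Suc R + i) mod Suc R = i"
  using div_mod_Suc[of i R g] by (simp only: mult.commute[of g] less_Suc_eq_le)

lemma decode_hub: "i \<le> R \<Longrightarrow> decode_vertex N R (hub_vertex N R g i) = Hub g i"
  using div_mod_Suc[of N N "Suc (g * Suc R + i)"] row_decode[of i R g]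
  by (simp only: decode_vertex_def hub_vertex_def Let_def lessI diff_Suc_1 simp_thms if_True if_False nat.distinct)

lemma decode_link: "i \<le> R \<Longrightarrow> t < N \<Longrightarrow> decode_vertex N R (link_vertex N R g i t) = Link g i t"
  using div_mod_Suc[of t N "Suc (g * Suc R + i)"] row_decode[of i R g]
  by (simp only: decode_vertex_def link_vertex_def Let_def less_SucI diff_Suc_1 simp_thms if_True if_False
    nat.distinct less_imp_neq)

text \<open>Numbers that encode no hub, link or base vertex are simply isolated vertices of the
  graph, so the numbering may have gaps.\<close>

definition vertex_count :: "nat \<Rightarrow> nat \<Rightarrow> nat \<Rightarrow> nat" where
  "vertex_count N R d = Suc N * Suc (d * Suc R)"

lemma row_bound:
  assumes "g < d" and "i \<le> R" and "t \<le> N"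
  shows "Suc N * Suc (g * Suc R + i) + t < vertex_count N R d"
proof -
  have "Suc (g * Suc R + i) \<le> Suc g * Suc R" using assms(2) by simp
  also have "\<dots> \<le> d * Suc R" using assms(1) by (intro mult_le_mono1) simp
  finally have "Suc N * Suc (g * Suc R + i) \<le> Suc N * (d * Suc R)" by (rule mult_le_mono2)
  then show ?thesis using assms(3) unfolding vertex_count_def by simp
qed

text \<open>One copy more than \<open>h\<close>: a total excess of at most \<open>h\<close> leaves
  some copy of every constraint without excess.\<close>

definition copies :: "nat \<Rightarrow> nat list list list \<Rightarrow> nat list list list" where
  "copies h D = concat (map (\<lambda>_. D) [0..<Suc h])"

text \<open>The total number of terms bounds the length of each single constraint, and it is
  computable without taking a maximum.\<close>

definition cover_graph :: "nat \<Rightarrow> nat list list list \<Rightarrow> graph_input" where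
  "cover_graph N D = (let R = length (concat D) in
     (vertex_count N R (length D), constraint_edges (hub_vertex N R) (link_vertex N R) D))"

text \<open>\<open>tl\<close> turns a constraint with \<open>r\<close> terms into a list of length
  \<open>r - 1\<close>, so the summed cost of the gadgets is obtained by list functions
  alone.\<close>

definition cover_instance :: "nat \<Rightarrow> nat \<Rightarrow> nat list list list \<Rightarrow> graph_input \<times> nat \<times> nat" where
  "cover_instance N h D = (cover_graph N (copies h D), N, h + length (concat (map tl (copies h D))))"

lemma constraint_graph_copies:
  assumes "\<And>L. L \<in> set D \<Longrightarrow> L \<noteq> []" and "\<And>L A t. L \<in> set D \<Longrightarrow> A \<in> set L \<Longrightarrow> t \<in> set A \<Longrightarrow> t < N"
    and "R = length (concat (copies h D))"
  shows "constraint_graph N h (vertex_count N R (length (copies h D))) (copies h D)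
    (hub_vertex N R) (link_vertex N R) (decode_vertex N R)"
proof -
  let ?D = "copies h D"
  have set: "set ?D = set D" by (auto simp: copies_def)
  have mem: "?D ! g \<in> set D" if "g < length ?D" for g using nth_mem[OF that] set by simp
  have mem': "?D ! g ! i \<in> set (?D ! g)" if "i < length (?D ! g)" for g i using that by (rule nth_mem)
  have "length L \<le> R" if "L \<in> set ?D" for L
    unfolding assms(3) length_concat using that by (intro member_le_sum_list) auto
  then have R: "length (?D ! g) \<le> R" if "g < length ?D" for g using that by simp
  show ?thesis
  proof
    fix g assume g: "g < length ?D"
    show "?D ! g \<noteq> []" using assms(1) mem[OF g] by blast
    have "length (filter ((=) (?D ! g)) (copies k D)) = Suc k * length (filter ((=) (?D ! g)) D)" for k
      by (induction k) (simp_all add: copies_def)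
    moreover have "length (filter ((=) (?D ! g)) D) > 0"
      using mem[OF g] by (simp add: filter_empty_conv)
    then have "Suc h * 1 \<le> Suc h * length (filter ((=) (?D ! g)) D)" by (intro mult_le_mono2) linarith
    ultimately have "h < length (filter ((=) (?D ! g)) ?D)" by simp
    then show "h < card {g'. g' < length ?D \<and> ?D ! g' = ?D ! g}"
      unfolding length_filter_conv_card by (simp add: eq_commute)
    fix i
    show "decode_vertex N R (hub_vertex N R g i) = Hub g i" if "i \<le> length (?D ! g)"
      using R[OF g] that by (intro decode_hub) simp
    show "hub_vertex N R g i < vertex_count N R (length ?D)" if "i \<le> length (?D ! g)"
      unfolding hub_vertex_def using R[OF g] that g by (intro row_bound) simp_all
    fix t assume i: "i < length (?D ! g)" and t: "t \<in> set (?D ! g ! i)"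
    show less: "t < N" using assms(2)[OF mem[OF g] mem'[OF i] t] .
    show "decode_vertex N R (link_vertex N R g i t) = Link g i t"
      using R[OF g] i less by (intro decode_link) simp_all
    show "link_vertex N R g i t < vertex_count N R (length ?D)"
      unfolding link_vertex_def using R[OF g] i less g by (intro row_bound) simp_all
  next
    show "decode_vertex N R t = Base t" if "t < N" for t using that by (rule decode_base)
    show "N \<le> vertex_count N R (length ?D)" by (simp add: vertex_count_def)
  qed
qed

lemma cover_instance_correct:
  assumes "\<And>L. L \<in> set D \<Longrightarrow> L \<noteq> []" and "\<And>L A t. L \<in> set D \<Longrightarrow> A \<in> set L \<Longrightarrow> t \<in> set A \<Longrightarrow> t < N"
    and "\<And>G :: nat graph. star_forest G \<Longrightarrow> \<Pi> G" and "\<And>G :: nat graph. \<Pi> G \<Longrightarrow> triangle_free G"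
    and "cover_instance N h D = (g, k, l)"
  shows "valid_graph_input g" "chordal_deletion_set (graph_of g) {..<N}" "k = N"
    "has_deletion_set \<Pi> (graph_of g) l \<longleftrightarrow>
      (\<exists>H \<subseteq> {..<N}. card H \<le> h \<and> (\<forall>L \<in> set D. \<exists>A \<in> set L. set A \<subseteq> H))"
proof -
  define R where "R = length (concat (copies h D))"
  interpret constraint_graph N h "vertex_count N R (length (copies h D))" "copies h D"
    "hub_vertex N R" "link_vertex N R" "decode_vertex N R"
    using assms(1,2) R_def by (rule constraint_graph_copies)
  have g: "g = input" and "k = N" and "l = h + length (concat (map tl (copies h D)))"
    using assms(5) unfolding cover_instance_def cover_graph_def R_def Let_def by auto
  moreover have "length (concat (map tl xs)) = (\<Sum>g < length xs. length (xs ! g) - 1)"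
    for xs :: "'z list list"
    by (simp add: length_concat comp_def sum_list_sum_nth atLeast0LessThan)
  ultimately have l: "l = budget" by (simp add: budget_def)
  show "valid_graph_input g" unfolding g by (rule valid_input)
  show "chordal_deletion_set (graph_of g) {..<N}" unfolding g by (rule chordal_deletion_set_base)
  show "k = N" by fact
  have "set (copies h D) = set D" by (auto simp: copies_def)
  then have sat: "satisfies H \<longleftrightarrow> (\<forall>L \<in> set D. \<exists>A \<in> set L. set A \<subseteq> H)" for H
    unfolding satisfies_def by simp
  show "has_deletion_set \<Pi> (graph_of g) l \<longleftrightarrow>
      (\<exists>H \<subseteq> {..<N}. card H \<le> h \<and> (\<forall>L \<in> set D. \<exists>A \<in> set L. set A \<subseteq> H))"
    unfolding g l sat[symmetric]
  proof
    assume "has_deletion_set \<Pi> G budget"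
    then show "\<exists>H \<subseteq> {..<N}. card H \<le> h \<and> satisfies H" using assms(4) by (rule satisfies_if_deletion)
  next
    assume "\<exists>H \<subseteq> {..<N}. card H \<le> h \<and> satisfies H"
    then obtain H where "satisfies H" "H \<subseteq> {..<N}" "card H \<le> h" by blast
    then show "has_deletion_set \<Pi> G budget" using assms(3) by (rule deletion_if_satisfies)
  qed
qed

section \<open>Computing the graph in polynomial time\<close>

abbreviation enc_dnfs :: "nat list list list \<Rightarrow> tree" where
  "enc_dnfs \<equiv> enc_list (enc_list (enc_list enc_nat))"

text \<open>After unfolding, only list functions and arithmetic with closure rules remain, so the
  rules find the program by following the syntax. Arguments appear as projections of a pair because
  the rules treat functions of one argument.\<close>

lemma poly_time_cover_graph:
  "poly_time (enc_pair enc_nat enc_dnfs) enc_graph (\<lambda>z. cover_graph (fst z) (snd z))"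
  unfolding cover_graph_def enc_graph_def Let_def constraint_edges_def gadget_edges_def
    hub_vertex_def link_vertex_def vertex_count_def
  by (rule poly_time_intros)+

lemma poly_time_copies:
  "poly_time (enc_pair enc_nat enc_dnfs) enc_dnfs (\<lambda>z. copies (fst z) (snd z))"
  unfolding copies_def by (rule poly_time_intros)+

lemma poly_time_cover_instance:
  assumes "poly_time e enc_nat N" and "poly_time e enc_nat h" and "poly_time e enc_dnfs D"
  shows "poly_time e (enc_pair enc_graph (enc_pair enc_nat enc_nat))
    (\<lambda>x. cover_instance (N x) (h x) (D x))"
proof -
  have c: "poly_time e enc_dnfs (\<lambda>x. copies (h x) (D x))"
    using poly_time_comp[OF poly_time_pair[OF assms(2,3)] poly_time_copies] by simp
  have g: "poly_time e enc_graph (\<lambda>x. cover_graph (N x) (copies (h x) (D x)))"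
    using poly_time_comp[OF poly_time_pair[OF assms(1) c] poly_time_cover_graph] by simp
  have "poly_time enc_dnfs enc_nat (\<lambda>D. length (concat (map tl D)))"
    by (rule poly_time_intros)+
  note poly_time_add[OF assms(2) poly_time_comp[OF c this]]
  then show ?thesis unfolding cover_instance_def by (intro poly_time_pair g assms(1))
qed

section \<open>Satisfiability as a covering problem\<close>

text \<open>Blocks of \<open>p\<close> variables are encoded by blocks of \<open>2 * m\<close> elements, of which exactly \<open>m\<close> are
  chosen. As all code words have the same size, a choice of this size that includes a code word is
  that code word, which makes negative literals expressible by inclusion as well.\<close>

locale code =
  fixes p m :: nat and word :: "bool list \<Rightarrow> nat list"
  assumes p_pos: "p > 0" and m_pos: "m > 0"
    and word_less: "length w = p \<Longrightarrow> e \<in> set (word w) \<Longrightarrow> e < 2 * m"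
    and card_word: "length w = p \<Longrightarrow> card (set (word w)) = m"
    and word_inj: "length w = p \<Longrightarrow> length w' = p \<Longrightarrow> set (word w) = set (word w') \<Longrightarrow> w = w'"
begin

definition shift :: "nat \<Rightarrow> nat list \<Rightarrow> nat list" where
  "shift b A = map (\<lambda>e. 2 * m * b + e) A"

text \<open>These become the terms of a literal with sign \<open>s\<close> at position
  \<open>r\<close> of its block: one term for each assignment of the block that makes the literal
  true. Their number is bounded by the constant \<open>2 ^ p\<close>.\<close>

definition words :: "bool \<Rightarrow> nat \<Rightarrow> nat list list" where
  "words s r = map word (filter (\<lambda>w. w ! r = s) (List.n_lists p [True, False]))"

definition block_constraint :: "nat \<Rightarrow> nat list list" where
  "block_constraint b = map (shift b) (map word (List.n_lists p [True, False]))"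

text \<open>The first term exceeds the share of block 0. It is there because constraints must be
  nonempty.\<close>

definition clause_constraint :: "clause \<Rightarrow> nat list list" where
  "clause_constraint C = [0..<2 * m] #
     concat (map (\<lambda>l. map (shift (snd l div p)) (words (fst l) (snd l mod p))) C)"

text \<open>Rounding down and adding 1 yields at least one block even for \<open>n = 0\<close>. So
  block 0, to which the first term of each clause constraint belongs, always exists.\<close>

definition blocks :: "nat \<Rightarrow> nat" where
  "blocks n = Suc (n div p)"

definition constraints :: "cnf \<Rightarrow> nat list list list" where
  "constraints \<phi> = map block_constraint [0..<blocks (fst \<phi>)] @ map clause_constraint (snd \<phi>)"

lemma set_n_lists_bool: "set (List.n_lists p [True, False]) = {w. length w = p}"
  by (auto simp: set_n_lists)

lemma set_block_constraint: "set (block_constraint b) = (\<lambda>w. shift b (word w)) ` {w. length w = p}"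
  unfolding block_constraint_def by (simp only: set_map set_n_lists_bool image_image)

lemma set_clause_constraint:
  "set (clause_constraint C) = insert [0..<2 * m]
    (\<Union>l \<in> set C. (\<lambda>w. shift (snd l div p) (word w)) ` {w. length w = p \<and> w ! (snd l mod p) = fst l})"
proof -
  have "set (words s r) = word ` {w. length w = p \<and> w ! r = s}" for s r
    unfolding words_def set_map set_filter set_n_lists_bool by simp
  then show ?thesis unfolding clause_constraint_def by (simp add: image_image)
qed

definition zone :: "nat \<Rightarrow> nat set" where
  "zone b = {2 * m * b..<2 * m * Suc b}"

lemma shift_word_zone: "length w = p \<Longrightarrow> set (shift b (word w)) \<subseteq> zone b"
  using word_less by (auto simp: shift_def zone_def)

lemma card_shift_word: "length w = p \<Longrightarrow> card (set (shift b (word w))) = m"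
  unfolding shift_def set_map by (subst card_image) (auto simp: card_word intro: inj_onI)

lemma zone_disjoint: "b \<noteq> b' \<Longrightarrow> zone b \<inter> zone b' = {}"
proof (induction b b' rule: linorder_wlog)
  case (le a b)
  then have "2 * m * Suc a \<le> 2 * m * b" by (intro mult_le_mono2) simp
  then show ?case unfolding zone_def by auto
next
  case (sym a b)
  then show ?case by (simp add: Int_commute)
qed

lemma zone_subset: "b < B \<Longrightarrow> zone b \<subseteq> {..<2 * m * B}"
proof -
  assume "b < B"
  then have "2 * m * Suc b \<le> 2 * m * B" by (intro mult_le_mono2) simp
  then show ?thesis unfolding zone_def by auto
qed

lemma block_less: "v < n \<Longrightarrow> v div p < blocks n"
  unfolding blocks_def less_Suc_eq_le by (rule div_le_mono) simp

context
  fixes n :: nat and F :: "clause list" and q :: nat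
  assumes cnf: "is_q_cnf q (n, F)"
begin

lemma var_less: "C \<in> set F \<Longrightarrow> l \<in> set C \<Longrightarrow> snd l < n"
  using cnf unfolding is_q_cnf_def by fastforce

lemma constraints_nonempty: "L \<in> set (constraints (n, F)) \<Longrightarrow> L \<noteq> []"
proof -
  have "length (replicate p True) = p" by simp
  then have "set (block_constraint b) \<noteq> {}" for b unfolding set_block_constraint by blast
  then have "[] \<noteq> block_constraint b" for b by (metis list.set(1))
  then show "L \<in> set (constraints (n, F)) \<Longrightarrow> L \<noteq> []"
    by (auto simp: constraints_def clause_constraint_def)
qed

lemma constraints_less:
  assumes "L \<in> set (constraints (n, F))" and "A \<in> set L" and "t \<in> set A"
  shows "t < 2 * m * blocks n"
proof -
  have word: "t < 2 * m * blocks n" if "b < blocks n" "length w = p" "A = shift b (word w)" for b w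
    using shift_word_zone[OF that(2), of b] zone_subset[OF that(1)] assms(3) that(3) by blast
  from assms(1) consider b where "b < blocks n" "L = block_constraint b"
    | C where "C \<in> set F" "L = clause_constraint C"
    unfolding constraints_def by auto
  then show ?thesis
  proof cases
    case 1
    then show ?thesis using word assms(2) set_block_constraint by blast
  next
    case 2
    from assms(2) show ?thesis unfolding 2(2) set_clause_constraint
    proof (elim insertE UN_E imageE CollectE conjE)
      assume "A = [0..<2 * m]"
      then have "t < 2 * m" using assms(3) by simp
      also have "2 * m \<le> 2 * m * blocks n" by (simp add: blocks_def)
      finally show ?thesis .
    next
      fix l w assume "l \<in> set C" "length w = p" "A = shift (snd l div p) (word w)"
      then show ?thesis using word[OF block_less[OF var_less[OF 2(1)]]] by blast
    qed
  qed
qed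

lemma cover_if_satisfiable:
  assumes "satisfiable (n, F)"
  shows "\<exists>H \<subseteq> {..<2 * m * blocks n}. card H \<le> m * blocks n \<and>
    (\<forall>L \<in> set (constraints (n, F)). \<exists>A \<in> set L. set A \<subseteq> H)"
proof -
  obtain \<sigma> where sat: "\<forall>C \<in> set F. \<exists>(s, v) \<in> set C. \<sigma> v = s"
    using assms unfolding satisfiable_def by auto
  \<comment> \<open>The last block may reach beyond variable \<open>n - 1\<close>; as \<sigma> is
    total, it is filled up with the values of \<sigma> there.\<close>
  define w where "w b = map (\<lambda>r. \<sigma> (b * p + r)) [0..<p]" for b
  have len: "length (w b) = p" for b by (simp add: w_def)
  define H where "H = (\<Union>b < blocks n. set (shift b (word (w b))))"
  have "H \<subseteq> {..<2 * m * blocks n}"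
    unfolding H_def using shift_word_zone[OF len] zone_subset by blast
  moreover have "card H \<le> (\<Sum>b < blocks n. card (set (shift b (word (w b)))))"
    unfolding H_def by (rule card_UN_le) simp
  then have "card H \<le> m * blocks n" by (simp add: card_shift_word[OF len] mult.commute)
  moreover have "\<exists>A \<in> set L. set A \<subseteq> H" if L: "L \<in> set (constraints (n, F))" for L
  proof -
    from L consider b where "b < blocks n" "L = block_constraint b"
      | C where "C \<in> set F" "L = clause_constraint C"
      unfolding constraints_def by auto
    then show ?thesis
    proof cases
      case 1
      have "shift b (word (w b)) \<in> set L" unfolding 1(2) set_block_constraint using len by blast
      moreover have "set (shift b (word (w b))) \<subseteq> H" unfolding H_def using 1(1) by blast
      ultimately show ?thesis by blast
    next
      case 2
      then obtain s v where sv: "(s, v) \<in> set C" "\<sigma> v = s" using sat by blast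
      let ?b = "v div p"
      have "w ?b ! (v mod p) = s" using p_pos sv(2) by (simp add: w_def)
      then have "shift ?b (word (w ?b)) \<in> set L"
        using sv(1) len[of ?b] unfolding 2(2) set_clause_constraint by force
      moreover have "?b < blocks n" using block_less var_less[OF 2(1) sv(1)] by simp
      then have "set (shift ?b (word (w ?b))) \<subseteq> H" unfolding H_def by blast
      ultimately show ?thesis by blast
    qed
  qed
  ultimately show ?thesis by (intro exI[of _ H]) simp
qed

text \<open>Each block constraint puts at least \<open>m\<close> elements into its zone, and the
  budget is \<open>m\<close> times the number of zones, so every zone contains exactly
  \<open>m\<close>. Hence only one code word fits into each zone. These words spell out an
  assignment, and a clause term included in \<open>H\<close> must be one of them.\<close>

lemma satisfiable_if_cover:
  assumes "H \<subseteq> {..<2 * m * blocks n}" and "card H \<le> m * blocks n"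
    and cover: "\<And>L. L \<in> set (constraints (n, F)) \<Longrightarrow> \<exists>A \<in> set L. set A \<subseteq> H"
  shows "satisfiable (n, F)"
proof -
  let ?B = "blocks n"
  have "finite H" using assms(1) finite_subset by blast
  have "\<exists>w. length w = p \<and> set (shift b (word w)) \<subseteq> H" if b: "b < ?B" for b
  proof -
    have "block_constraint b \<in> set (constraints (n, F))" using b by (simp add: constraints_def)
    from cover[OF this] show ?thesis unfolding set_block_constraint by blast
  qed
  then obtain w where w: "\<And>b. b < ?B \<Longrightarrow> length (w b) = p"
    "\<And>b. b < ?B \<Longrightarrow> set (shift b (word (w b))) \<subseteq> H" by metis
  have ge: "m \<le> card (H \<inter> zone b)" if b: "b < ?B" for b
    using card_mono[of "H \<inter> zone b" "set (shift b (word (w b)))"] \<open>finite H\<close> w[OF b]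
      shift_word_zone[OF w(1)[OF b], of b] card_shift_word[OF w(1)[OF b], of b] by simp
  have "(\<Sum>b < ?B. card (H \<inter> zone b)) = card (\<Union>b < ?B. H \<inter> zone b)"
    by (rule card_UN_disjoint[symmetric]) (use \<open>finite H\<close> zone_disjoint in auto)
  also have "\<dots> \<le> card H" using \<open>finite H\<close> by (intro card_mono) auto
  finally have sum: "(\<Sum>b < ?B. card (H \<inter> zone b)) \<le> (\<Sum>b < ?B. m)"
    using assms(2) by (simp add: mult.commute)
  have card: "card (H \<inter> zone b) = m" if b: "b < ?B" for b
  proof (rule ccontr)
    assume "card (H \<inter> zone b) \<noteq> m"
    then have "m < card (H \<inter> zone b)" using ge[OF b] by simp
    then have "(\<Sum>b < ?B. m) < (\<Sum>b < ?B. card (H \<inter> zone b))"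
      using ge b by (intro sum_strict_mono_ex1) auto
    then show False using sum by simp
  qed
  \<comment> \<open>A code word included in \<open>H\<close> has \<open>m\<close> elements, as many
    as \<open>H\<close> has in the zone, so it is all of that part.\<close>
  have unique: "v = w b" if b: "b < ?B" and v: "length v = p" "set (shift b (word v)) \<subseteq> H" for b v
  proof -
    have eq: "set (shift b (word u)) = H \<inter> zone b" if u: "length u = p" "set (shift b (word u)) \<subseteq> H" for u
      using \<open>finite H\<close> shift_word_zone[OF u(1), of b] u(2) card_shift_word[OF u(1), of b] card[OF b]
      by (intro card_subset_eq) auto
    have "(+) (2 * m * b) ` set (word v) = (+) (2 * m * b) ` set (word (w b))"
      using eq[OF v] eq[OF w(1)[OF b] w(2)[OF b]] unfolding shift_def set_map by simp
    then have "set (word v) = set (word (w b))" by (simp add: inj_image_eq_iff)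
    then show ?thesis using word_inj v(1) w(1)[OF b] by blast
  qed
  define \<sigma> where "\<sigma> v = w (v div p) ! (v mod p)" for v
  have "\<exists>(s, v) \<in> set C. \<sigma> v = s" if C: "C \<in> set F" for C
  proof -
    have "clause_constraint C \<in> set (constraints (n, F))" using C by (simp add: constraints_def)
    then obtain A where "A \<in> set (clause_constraint C)" and AH: "set A \<subseteq> H" using cover by blast
    from this(1) show ?thesis unfolding set_clause_constraint
    proof (elim insertE UN_E imageE CollectE conjE)
      \<comment> \<open>This term would put all \<open>2 * m\<close> elements of zone 0 into
        \<open>H\<close>, but there are only \<open>m < 2 * m\<close>.\<close>
      assume "A = [0..<2 * m]"
      then have "zone 0 \<subseteq> H \<inter> zone 0" using AH by (auto simp: zone_def)
      then have "card (zone 0) \<le> card (H \<inter> zone 0)" using \<open>finite H\<close> by (intro card_mono) auto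
      then show ?thesis using card[of 0] m_pos by (simp add: zone_def blocks_def)
    next
      fix l u assume l: "l \<in> set C" and u: "length u = p" "u ! (snd l mod p) = fst l"
        and A: "A = shift (snd l div p) (word u)"
      have "u = w (snd l div p)"
        using unique[OF block_less[OF var_less[OF C l]] u(1)] AH A by simp
      then have "\<sigma> (snd l) = fst l" using u(2) by (simp add: \<sigma>_def)
      then show ?thesis using l by (intro bexI[of _ l]) (simp_all add: case_prod_beta)
    qed
  qed
  then show ?thesis unfolding satisfiable_def by auto
qed

lemma satisfiable_iff_cover:
  "satisfiable (n, F) \<longleftrightarrow> (\<exists>H \<subseteq> {..<2 * m * blocks n}. card H \<le> m * blocks n \<and>
    (\<forall>L \<in> set (constraints (n, F)). \<exists>A \<in> set L. set A \<subseteq> H))"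
proof
  assume "satisfiable (n, F)"
  then show "\<exists>H \<subseteq> {..<2 * m * blocks n}. card H \<le> m * blocks n \<and>
    (\<forall>L \<in> set (constraints (n, F)). \<exists>A \<in> set L. set A \<subseteq> H)" by (rule cover_if_satisfiable)
next
  assume "\<exists>H \<subseteq> {..<2 * m * blocks n}. card H \<le> m * blocks n \<and>
    (\<forall>L \<in> set (constraints (n, F)). \<exists>A \<in> set L. set A \<subseteq> H)"
  then obtain H where H: "H \<subseteq> {..<2 * m * blocks n}" "card H \<le> m * blocks n"
    "\<forall>L \<in> set (constraints (n, F)). \<exists>A \<in> set L. set A \<subseteq> H" by (elim exE conjE)
  show "satisfiable (n, F)" by (rule satisfiable_if_cover[OF H(1,2) bspec[OF H(3)]])
qed

end

section \<open>Computing the reduction in polynomial time\<close>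

abbreviation enc_cnf :: "cnf \<Rightarrow> tree" where
  "enc_cnf \<equiv> enc_pair enc_nat (enc_list (enc_list (enc_pair enc_bool enc_nat)))"

lemma poly_time_shift [poly_time_intros]:
  assumes "poly_time e enc_nat b" and "poly_time e (enc_list enc_nat) A"
  shows "poly_time e (enc_list enc_nat) (\<lambda>x. shift (b x) (A x))"
proof -
  have "poly_time (enc_pair enc_nat (enc_list enc_nat)) (enc_list enc_nat) (\<lambda>z. shift (fst z) (snd z))"
    unfolding shift_def by (rule poly_time_intros)+
  from poly_time_comp[OF poly_time_pair[OF assms] this] show ?thesis by simp
qed

text \<open>For each of the two signs the result depends only on a residue modulo the constant
  \<open>p\<close>, so it is looked up in a finite table and \<open>word\<close> itself never has to
  be computed.\<close>

lemma poly_time_words [poly_time_intros]: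
  assumes "poly_time e enc_bool s" and "poly_time e enc_nat v"
  shows "poly_time e (enc_list (enc_list enc_nat)) (\<lambda>x. words (s x) (v x mod p))"
proof -
  have "poly_time e (enc_list (enc_list enc_nat))
      (\<lambda>x. if s x then words True (v x mod p) else words False (v x mod p))"
    by (intro poly_time_if_bool poly_time_mod_fun[OF p_pos] assms)
  moreover have "(if s x then words True r else words False r) = words (s x) r" for x r
    by (cases "s x") simp_all
  ultimately show ?thesis by simp
qed

lemma poly_time_blocks: "poly_time enc_cnf enc_nat (\<lambda>\<phi>. blocks (fst \<phi>))"
  unfolding blocks_def by (rule poly_time_intros poly_time_div[OF p_pos])+

lemma poly_time_constraints: "poly_time enc_cnf enc_dnfs constraints"
proof -
  have "poly_time enc_cnf enc_dnfs (\<lambda>\<phi>. constraints \<phi>)"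
    unfolding constraints_def block_constraint_def clause_constraint_def
    by (rule poly_time_blocks poly_time_div[OF p_pos] poly_time_intros)+
  then show ?thesis by simp
qed

definition reduction :: "cnf \<Rightarrow> graph_input \<times> nat \<times> nat" where
  "reduction \<phi> = cover_instance (2 * m * blocks (fst \<phi>)) (m * blocks (fst \<phi>)) (constraints \<phi>)"

lemma poly_time_reduction:
  "poly_time enc_cnf (enc_pair enc_graph (enc_pair enc_nat enc_nat)) reduction"
  "poly_time enc_cnf (enc_pair (enc_list enc_nat) (enc_pair enc_graph (enc_pair enc_nat enc_nat)))
    (\<lambda>\<phi>. ([0..<2 * m * blocks (fst \<phi>)], reduction \<phi>))"
proof -
  have "poly_time enc_cnf (enc_pair enc_graph (enc_pair enc_nat enc_nat)) (\<lambda>\<phi>. reduction \<phi>)"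
    unfolding reduction_def
    by (intro poly_time_cover_instance poly_time_mult poly_time_const poly_time_blocks poly_time_constraints)
  then show "poly_time enc_cnf (enc_pair enc_graph (enc_pair enc_nat enc_nat)) reduction" by simp
  then show "poly_time enc_cnf (enc_pair (enc_list enc_nat) (enc_pair enc_graph (enc_pair enc_nat enc_nat)))
    (\<lambda>\<phi>. ([0..<2 * m * blocks (fst \<phi>)], reduction \<phi>))"
    by (intro poly_time_pair poly_time_upt poly_time_mult poly_time_const poly_time_blocks) simp
qed

lemma reduction_correct:
  assumes "is_q_cnf q \<phi>" and "reduction \<phi> = (g, k, l)"
    and "\<And>G :: nat graph. star_forest G \<Longrightarrow> \<Pi> G" and "\<And>G :: nat graph. \<Pi> G \<Longrightarrow> triangle_free G"
  shows "valid_graph_input g" "chordal_deletion_set (graph_of g) {..<2 * m * blocks (fst \<phi>)}"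
    "k = 2 * m * blocks (fst \<phi>)" "has_deletion_set \<Pi> (graph_of g) l \<longleftrightarrow> satisfiable \<phi>"
proof -
  obtain n F where \<phi>: "\<phi> = (n, F)" by (cases \<phi>)
  note cnf = assms(1)[unfolded \<phi>]
  note correct = cover_instance_correct[OF constraints_nonempty[OF cnf] constraints_less[OF cnf]
    assms(3,4) assms(2)[unfolded reduction_def \<phi> fst_conv]]
  show "valid_graph_input g" by (rule correct(1))
  show "chordal_deletion_set (graph_of g) {..<2 * m * blocks (fst \<phi>)}"
    unfolding \<phi> fst_conv by (rule correct(2))
  show "k = 2 * m * blocks (fst \<phi>)" unfolding \<phi> fst_conv by (rule correct(3))
  show "has_deletion_set \<Pi> (graph_of g) l \<longleftrightarrow> satisfiable \<phi>"
    unfolding \<phi> satisfiable_iff_cover[OF cnf] by (rule correct(4))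
qed

end

section \<open>Transfer of running times\<close>

text \<open>Excludes time bounds that are zero or negative, which arise for \<epsilon> \<ge>
  2.\<close>

lemma exec_time_pos: "exec c s t s' \<Longrightarrow> t > 0"
  by (induction rule: exec.induct) auto

text \<open>The central binomial coefficient is at least \<open>4 ^ m / (2 * m)\<close>. If
  \<open>2 * m\<close> is \<open>4 ^ k\<close>, this quotient is exactly
  \<open>2 ^ (2 * m - 2 * k)\<close>, so \<open>p = 2 * m - 2 * k\<close> bits can be encoded. The
  rate \<open>p / (2 * m) = 1 - 2 * k / 4 ^ k\<close> tends to 1.\<close>

lemma exists_code:
  fixes \<gamma> :: real
  assumes "\<gamma> < 1"
  obtains p m word where "code p m word" "\<gamma> * real (2 * m) < real p"
proof -
  obtain j where j: "2 / (1 - \<gamma>) < 2 ^ j" using real_arch_pow[of 2 "2 / (1 - \<gamma>)"] by auto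
  define k where "k = Suc j"
  have "(2 :: real) ^ j \<le> 2 ^ k" unfolding k_def by (intro power_increasing) auto
  then have "2 / (1 - \<gamma>) < 2 ^ k" using j by linarith
  then have k: "2 < (1 - \<gamma>) * 2 ^ k" using assms by (simp add: field_simps)
  \<comment> \<open>Chosen so that \<open>2 * m\<close> is a power of 4; \<open>k = Suc j\<close> is
    positive, which makes the half of \<open>4 ^ k\<close> an integer.\<close>
  define m :: nat where "m = 2 ^ (2 * j + 1)"
  have m: "2 * m = 4 ^ k" by (simp add: m_def k_def power_mult power_add)
  have "k < 2 ^ k" by (rule less_exp)
  have sq: "(4 :: real) ^ k = 2 ^ k * 2 ^ k" by (simp flip: power_mult_distrib)
  have "2 * real k < 2 * 2 ^ k" using \<open>k < 2 ^ k\<close> by (metis mult_less_cancel_left_pos of_nat_less_iff of_nat_numeral of_nat_power zero_less_numeral)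
  also have "\<dots> \<le> (1 - \<gamma>) * 2 ^ k * 2 ^ k" using k by (intro mult_right_mono) auto
  finally have room: "2 * real k < (1 - \<gamma>) * real (2 * m)" unfolding m by (simp add: sq)
  have "2 * k \<le> 2 * m"
  proof -
    have "k \<le> 2 ^ k" "(2 :: nat) \<le> 2 ^ k" using \<open>k < 2 ^ k\<close> by (auto simp: k_def)
    then have "2 * k \<le> 2 ^ k * 2 ^ k" by (intro mult_le_mono) auto
    then show ?thesis unfolding m by (simp flip: power_mult_distrib)
  qed
  define p where "p = 2 * m - 2 * k"
  have p: "real p = real (2 * m) - 2 * real k" using \<open>2 * k \<le> 2 * m\<close> by (simp add: p_def)
  then have bound: "\<gamma> * real (2 * m) < real p" using room by (simp add: algebra_simps)
  \<comment> \<open>Needs its own argument, since \<open>bound\<close> does not imply it for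
    negative \<gamma>.\<close>
  have "p \<noteq> 0"
  proof
    assume "p = 0"
    then have "2 * real k = real (2 * m)" using p by simp
    moreover have "k < m"
    proof -
      have "2 ^ k \<le> (2 :: nat) ^ (2 * j + 1)" unfolding k_def by (intro power_increasing) auto
      then show ?thesis using \<open>k < 2 ^ k\<close> unfolding m_def by linarith
    qed
    ultimately show False by simp
  qed
  have "m > 0" by (simp add: m_def)
  have "2 ^ p * (2 * m) = (2 :: nat) ^ (p + 2 * k)"
    unfolding m by (simp add: power_add power_mult)
  also have "p + 2 * k = 2 * m" using \<open>2 * k \<le> 2 * m\<close> by (simp add: p_def)
  also have "(2 :: nat) ^ (2 * m) = 4 ^ m" by (simp add: power_mult)
  finally have "real (2 ^ p * (2 * m)) = real (4 ^ m)" by (rule arg_cong)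
  then have "2 ^ p = 4 ^ m / (2 * real m)" using \<open>m > 0\<close> by (simp add: field_simps)
  also have "\<dots> \<le> real ((2 * m) choose m)" using \<open>m > 0\<close> by (rule central_binomial_lower_bound)
  finally have "2 ^ p \<le> (2 * m) choose m" by (metis of_nat_le_iff of_nat_numeral of_nat_power)
  moreover define S where "S = {A. A \<subseteq> {..<2 * m} \<and> card A = m}"
  have "card S = (2 * m) choose m" unfolding S_def by (simp add: n_subsets)
  moreover have "card {w :: bool list. length w = p} = 2 ^ p"
    using card_lists_length_eq[of "UNIV :: bool set" p] by simp
  moreover have "finite {w :: bool list. length w = p}" "finite S"
    using finite_lists_length_eq[of "UNIV :: bool set" p] by (simp_all add: S_def)
  \<comment> \<open>Any injection from assignments to sets of size \<open>m\<close> will do, because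
    its finitely many values are hard-wired into the reduction.\<close>
  ultimately obtain f where f: "f ` {w :: bool list. length w = p} \<subseteq> S" "inj_on f {w. length w = p}"
    by (metis card_le_inj)
  define word where "word w = sorted_list_of_set (f w)" for w
  have S: "f w \<subseteq> {..<2 * m}" "card (f w) = m" if "length w = p" for w
    using f(1) that unfolding S_def by blast+
  have set: "set (word w) = f w" if "length w = p" for w
    unfolding word_def using S(1)[OF that] finite_subset by (intro set_sorted_list_of_set) blast
  have "code p m word"
  proof
    show "p > 0" "m > 0" using \<open>p \<noteq> 0\<close> \<open>m > 0\<close> by simp_all
    fix w :: "bool list" assume w: "length w = p"
    show "e < 2 * m" if "e \<in> set (word w)" for e using that S(1)[OF w] unfolding set[OF w] by blast
    show "card (set (word w)) = m" unfolding set[OF w] by (rule S(2)[OF w])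
    fix w' :: "bool list" assume w': "length w' = p" "set (word w) = set (word w')"
    then have "f w = f w'" using set[OF w] set[OF w'(1)] by simp
    then show "w = w'" using f(2) w w'(1) by (auto dest: inj_onD)
  qed
  then show thesis using bound by (rule that)
qed

text \<open>The parameter is at most \<open>2 * m * (n / p + 1)\<close>. The part proportional to
  \<open>n\<close> gives the exponent, the summand 1 contributes the constant factor
  \<open>c ^ (2 * m)\<close>, and this factor and the time of the reduction disappear in the
  polynomial.\<close>

lemma sat_solvable_if_reduction:
  fixes c :: real
  assumes solver: "solvable_in_Ostar P (\<lambda>k. c ^ k)" and "c \<ge> 1" and "p > 0"
    and f: "poly_time (encode (q_SAT q)) (encode P) f"
    and inst: "\<And>\<phi>. is_q_cnf q \<phi> \<Longrightarrow> f \<phi> \<in> instances P"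
    and yes: "\<And>\<phi>. is_q_cnf q \<phi> \<Longrightarrow> yes_instance P (f \<phi>) \<longleftrightarrow> satisfiable \<phi>"
    and param: "\<And>\<phi>. is_q_cnf q \<phi> \<Longrightarrow> parameter P (f \<phi>) = 2 * m * Suc (fst \<phi> div p)"
  shows "solvable_in_Ostar (q_SAT q) (\<lambda>n. 2 powr (log 2 c * real (2 * m) / real p * real n))"
proof -
  let ?e = "encode (q_SAT q)"
  define \<delta> where "\<delta> = log 2 c * real (2 * m) / real p"
  have "\<delta> \<ge> 0" using assms(2) by (simp add: \<delta>_def)
  from solver obtain d r where d: "\<forall>I \<in> instances P. decides_within d (encode P I) (yes_instance P I)
      (c ^ parameter P I * real (poly r (size (encode P I))))"
    unfolding solvable_in_Ostar_def by blast
  obtain a T where a: "\<forall>\<phi>. \<exists>t \<le> T \<phi>. exec a (init_state (?e \<phi>)) t (init_state (encode P (f \<phi>)))"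
    and T: "poly_bounded ?e T" using poly_timeD[OF f] by blast
  from T obtain pT where pT: "\<forall>\<phi>. T \<phi> \<le> poly pT (size (?e \<phi>))" unfolding poly_bounded_def by blast
  from poly_time_size[OF f] obtain ps where ps: "\<forall>\<phi>. size (encode P (f \<phi>)) \<le> poly ps (size (?e \<phi>))"
    unfolding poly_bounded_def by blast
  \<comment> \<open>Rounded up, because the polynomial of the running time has natural
    coefficients.\<close>
  define K where "K = nat \<lceil>c ^ (2 * m)\<rceil>"
  have K: "c ^ (2 * m) \<le> real K" unfolding K_def by (rule real_nat_ceiling_ge)
  define s where "s = pT + [:K:] * pcompose r ps"
  have growth: "c ^ (2 * m * Suc (n div p)) \<le> real K * 2 powr (\<delta> * real n)" for n
  proof -
    have "c ^ (2 * m * (n div p)) = c powr (real (2 * m) * real (n div p))"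
      using assms(2) by (simp add: powr_realpow flip: of_nat_mult)
    also have "\<dots> \<le> c powr (real (2 * m) * (real n / real p))"
      using assms(2) of_nat_div_le_of_nat[where ?'a = real, of n p] by (intro powr_mono mult_left_mono) auto
    also have "\<dots> = (2 powr log 2 c) powr (real (2 * m) * (real n / real p))" using assms(2) by simp
    also have "\<dots> = 2 powr (\<delta> * real n)" unfolding powr_powr \<delta>_def by (simp add: mult_ac)
    finally have "c ^ (2 * m) * c ^ (2 * m * (n div p)) \<le> real K * 2 powr (\<delta> * real n)"
      using K assms(2) by (intro mult_mono) auto
    then show ?thesis by (simp add: power_add)
  qed
  have "decides_within (Seq a d) (?e \<phi>) (satisfiable \<phi>)
      (2 powr (\<delta> * real (fst \<phi>)) * real (poly s (size (?e \<phi>))))" if \<phi>: "is_q_cnf q \<phi>" for \<phi>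
  proof -
    let ?z = "2 powr (\<delta> * real (fst \<phi>))" and ?n = "size (?e \<phi>)"
    obtain t where t: "t \<le> T \<phi>" "exec a (init_state (?e \<phi>)) t (init_state (encode P (f \<phi>)))"
      using a by blast
    have "decides_within d (encode P (f \<phi>)) (satisfiable \<phi>)
        (c ^ (2 * m * Suc (fst \<phi> div p)) * real (poly r (size (encode P (f \<phi>)))))"
      using bspec[OF d inst[OF \<phi>]] unfolding yes[OF \<phi>] param[OF \<phi>] .
    then obtain u s' where u: "exec d (init_state (encode P (f \<phi>))) u s'" "s' 0 \<noteq> Leaf \<longleftrightarrow> satisfiable \<phi>"
      "real u \<le> c ^ (2 * m * Suc (fst \<phi> div p)) * real (poly r (size (encode P (f \<phi>))))"
      unfolding decides_within_def by blast
    have "poly r (size (encode P (f \<phi>))) \<le> poly r (poly ps ?n)" using ps by (intro poly_nat_mono) blast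
    then have "real u \<le> real K * ?z * real (poly r (poly ps ?n))"
      using growth[of "fst \<phi>"] assms(2) by (intro order_trans[OF u(3)] mult_mono) auto
    moreover have "1 \<le> ?z" using \<open>\<delta> \<ge> 0\<close> by (intro ge_one_powr_ge_zero) auto
    then have "1 * real (poly pT ?n) \<le> ?z * real (poly pT ?n)" by (intro mult_right_mono) auto
    moreover have "real t \<le> real (poly pT ?n)" using t(1) pT[rule_format, of \<phi>] by linarith
    moreover have "?z * real (poly s ?n) = ?z * real (poly pT ?n) + real K * ?z * real (poly r (poly ps ?n))"
      unfolding s_def by (simp add: poly_pcompose algebra_simps)
    ultimately have "real (t + u) \<le> ?z * real (poly s ?n)" by simp
    then show ?thesis unfolding decides_within_def using exec.Seq[OF t(2) u(1)] u(2) by blast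
  qed
  then show ?thesis unfolding solvable_in_Ostar_def \<delta>_def[symmetric]
    by (intro exI[of _ "Seq a d"] exI[of _ s]) (simp add: q_SAT_def)
qed

text \<open>A single \<delta> for all \<open>q\<close> bounds every term of the sequence
  \<open>sat_exponent\<close>, and therefore its limit 1.\<close>

lemma SETH_solvable:
  assumes "SETH" and "\<delta> \<ge> 0"
    and "\<And>q. solvable_in_Ostar (q_SAT q) (\<lambda>n. 2 powr (\<delta> * real n))"
  shows "\<delta> \<ge> 1"
proof -
  have "sat_exponent q \<le> \<delta>" for q
    unfolding sat_exponent_def using assms(2,3)
    by (intro cInf_lower bdd_belowI[of _ 0]) auto
  then show ?thesis using assms(1) unfolding SETH_def by (intro LIMSEQ_le_const2) auto
qed

text \<open>A base \<open>c < 2\<close> has \<open>log 2 c < 1\<close>. A code whose rate exceeds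
  \<open>log 2 c\<close> makes the exponent \<open>log 2 c * 2 * m / p\<close> smaller than 1,
  simultaneously for all \<open>q\<close>.\<close>

lemma not_solvable_if_reductions:
  fixes \<epsilon> :: real
  assumes "SETH" and "\<epsilon> > 0" and one: "I \<in> instances P" "parameter P I = 1"
    and red: "\<And>p m word q. code p m word \<Longrightarrow> \<exists>f. poly_time (encode (q_SAT q)) (encode P) f \<and>
      (\<forall>\<phi>. is_q_cnf q \<phi> \<longrightarrow> f \<phi> \<in> instances P \<and> (yes_instance P (f \<phi>) \<longleftrightarrow> satisfiable \<phi>) \<and>
        parameter P (f \<phi>) = 2 * m * Suc (fst \<phi> div p))"
  shows "\<not> solvable_in_Ostar P (\<lambda>k. (2 - \<epsilon>) ^ k)"
proof
  assume solver: "solvable_in_Ostar P (\<lambda>k. (2 - \<epsilon>) ^ k)"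
  then obtain d r where d: "\<forall>I \<in> instances P. decides_within d (encode P I) (yes_instance P I)
      ((2 - \<epsilon>) ^ parameter P I * real (poly r (size (encode P I))))"
    unfolding solvable_in_Ostar_def by blast
  \<comment> \<open>For larger \<epsilon> the base is not positive, but its even powers may still be
    large. So the contradiction comes from the instance with parameter 1, whose time bound is at
    most 0.\<close>
  have "\<epsilon> < 2"
  proof (rule ccontr)
    assume "\<not> \<epsilon> < 2"
    then have le: "(2 - \<epsilon>) * real x \<le> 0" for x by (intro mult_nonpos_nonneg) auto
    obtain t s' where "exec d (init_state (encode P I)) t s'"
      "real t \<le> (2 - \<epsilon>) * real (poly r (size (encode P I)))"
      using bspec[OF d one(1)] one(2) unfolding decides_within_def by auto
    then show False using exec_time_pos[of d _ t s'] le[of "poly r (size (encode P I))"] by fastforce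
  qed
  \<comment> \<open>For \<epsilon> > 1 the base \<open>2 - \<epsilon>\<close> is below 1 and its
    logarithm negative; raising it to 1 weakens the time bound and keeps the exponent
    nonnegative.\<close>
  define c where "c = max 1 (2 - \<epsilon>)"
  have c: "1 \<le> c" "c < 2" using assms(2) by (auto simp: c_def)
  have pow: "(2 - \<epsilon>) ^ k \<le> c ^ k" for k
    using \<open>\<epsilon> < 2\<close> by (intro power_mono) (auto simp: c_def)
  have c_solver: "solvable_in_Ostar P (\<lambda>k. c ^ k)"
    unfolding solvable_in_Ostar_def
  proof (intro exI ballI)
    fix I assume "I \<in> instances P"
    moreover have "(2 - \<epsilon>) ^ parameter P I * real (poly r (size (encode P I))) \<le>
        c ^ parameter P I * real (poly r (size (encode P I)))"
      by (intro mult_right_mono pow) simp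
    ultimately show "decides_within d (encode P I) (yes_instance P I)
        (c ^ parameter P I * real (poly r (size (encode P I))))"
      using bspec[OF d, of I] unfolding decides_within_def by (meson order_trans)
  qed
  have "log 2 c < 1" using c by (simp add: log_less_one_cancel_iff)
  then obtain p m word where code: "code p m word" and small: "log 2 c * real (2 * m) < real p"
    by (rule exists_code)
  have "p > 0" using code by (rule code.p_pos)
  let ?\<delta> = "log 2 c * real (2 * m) / real p"
  have "solvable_in_Ostar (q_SAT q) (\<lambda>n. 2 powr (?\<delta> * real n))" for q
  proof -
    obtain f where f: "poly_time (encode (q_SAT q)) (encode P) f"
      "\<forall>\<phi>. is_q_cnf q \<phi> \<longrightarrow> f \<phi> \<in> instances P \<and> (yes_instance P (f \<phi>) \<longleftrightarrow> satisfiable \<phi>) \<and>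
        parameter P (f \<phi>) = 2 * m * Suc (fst \<phi> div p)" using red[OF code, of q] by (elim exE conjE)
    show ?thesis
      by (rule sat_solvable_if_reduction[OF c_solver c(1) \<open>p > 0\<close> f(1)]) (use f(2) in blast)+
  qed
  moreover have "?\<delta> \<ge> 0" using c(1) by simp
  ultimately have "?\<delta> \<ge> 1" using assms(1) SETH_solvable by blast
  then show False using small \<open>p > 0\<close> by (simp add: field_simps)
qed

section \<open>Hardness of the deletion problems\<close>

lemma chordal_deletion_set_singleton: "chordal_deletion_set (graph_of (Suc 0, [])) {0}"
proof -
  have "\<not> is_cycle (delete_vertices (graph_of (Suc 0, [])) {0}) vs" for vs
    by (auto simp: is_cycle_def delete_vertices_def graph_of_def lessThan_Suc)
  then show ?thesis by (simp add: chordal_deletion_set_def chordal_def graph_of_def)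
qed

text \<open>All that enters about \<Pi> is its position between star forests and triangle-free
  graphs. Both input formats use the same reduction; when the modulator is part of the input, the
  list of base vertices is output as well.\<close>

lemma deletion_by_cvd_hard:
  fixes \<epsilon> :: real
  assumes "SETH" and "\<epsilon> > 0"
    and \<Pi>: "\<And>G :: nat graph. star_forest G \<Longrightarrow> \<Pi> G" "\<And>G :: nat graph. \<Pi> G \<Longrightarrow> triangle_free G"
  shows "\<not> solvable_in_Ostar (deletion_by_cvd \<Pi>) (\<lambda>k. (2 - \<epsilon>) ^ k)"
    and "\<not> solvable_in_Ostar (deletion_by_given_cvd \<Pi>) (\<lambda>k. (2 - \<epsilon>) ^ k)"
proof -
  show "\<not> solvable_in_Ostar (deletion_by_cvd \<Pi>) (\<lambda>k. (2 - \<epsilon>) ^ k)"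
  \<comment> \<open>A single vertex that is its own modulator serves as the instance with parameter
    1.\<close>
  proof (rule not_solvable_if_reductions[OF assms(1,2), where I = "((1, []), 1, 0)"])
    show "((1, []), 1, 0) \<in> instances (deletion_by_cvd \<Pi>)"
      using chordal_deletion_set_singleton by (force simp: deletion_by_cvd_def valid_graph_input_def)
    show "parameter (deletion_by_cvd \<Pi>) ((1, []), 1, 0) = 1" by (simp add: deletion_by_cvd_def)
    fix p m word q assume "code p m word"
    then interpret code p m word .
    have "reduction \<phi> \<in> instances (deletion_by_cvd \<Pi>) \<and>
        (yes_instance (deletion_by_cvd \<Pi>) (reduction \<phi>) \<longleftrightarrow> satisfiable \<phi>) \<and>
        parameter (deletion_by_cvd \<Pi>) (reduction \<phi>) = 2 * m * Suc (fst \<phi> div p)"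
      if \<phi>: "is_q_cnf q \<phi>" for \<phi>
    proof -
      obtain g k l where r: "reduction \<phi> = (g, k, l)" by (cases "reduction \<phi>")
      note correct = reduction_correct[OF \<phi> r \<Pi>]
      then have "chordal_deletion_set (graph_of g) {..<k}" by simp
      then have "\<exists>S. chordal_deletion_set (graph_of g) S \<and> card S = k" by (metis card_lessThan)
      then show ?thesis using correct unfolding r by (simp add: deletion_by_cvd_def blocks_def)
    qed
    then show "\<exists>f. poly_time (encode (q_SAT q)) (encode (deletion_by_cvd \<Pi>)) f \<and>
      (\<forall>\<phi>. is_q_cnf q \<phi> \<longrightarrow> f \<phi> \<in> instances (deletion_by_cvd \<Pi>) \<and>
        (yes_instance (deletion_by_cvd \<Pi>) (f \<phi>) \<longleftrightarrow> satisfiable \<phi>) \<and>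
        parameter (deletion_by_cvd \<Pi>) (f \<phi>) = 2 * m * Suc (fst \<phi> div p))"
      using poly_time_reduction(1)
      by (intro exI[of _ reduction]) (simp add: q_SAT_def deletion_by_cvd_def)
  qed
  show "\<not> solvable_in_Ostar (deletion_by_given_cvd \<Pi>) (\<lambda>k. (2 - \<epsilon>) ^ k)"
  proof (rule not_solvable_if_reductions[OF assms(1,2), where I = "([0], (1, []), 1, 0)"])
    show "([0], (1, []), 1, 0) \<in> instances (deletion_by_given_cvd \<Pi>)"
      using chordal_deletion_set_singleton by (simp add: deletion_by_given_cvd_def valid_graph_input_def)
    show "parameter (deletion_by_given_cvd \<Pi>) ([0], (1, []), 1, 0) = 1"
      by (simp add: deletion_by_given_cvd_def)
    fix p m word q assume "code p m word"
    then interpret code p m word .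
    let ?f = "\<lambda>\<phi>. ([0..<2 * m * blocks (fst \<phi>)], reduction \<phi>)"
    have "?f \<phi> \<in> instances (deletion_by_given_cvd \<Pi>) \<and>
        (yes_instance (deletion_by_given_cvd \<Pi>) (?f \<phi>) \<longleftrightarrow> satisfiable \<phi>) \<and>
        parameter (deletion_by_given_cvd \<Pi>) (?f \<phi>) = 2 * m * Suc (fst \<phi> div p)"
      if \<phi>: "is_q_cnf q \<phi>" for \<phi>
    proof -
      obtain g k l where r: "reduction \<phi> = (g, k, l)" by (cases "reduction \<phi>")
      note correct = reduction_correct[OF \<phi> r \<Pi>]
      then show ?thesis unfolding r
        by (simp add: deletion_by_given_cvd_def blocks_def atLeast0LessThan del: upt_Suc)
    qed
    then show "\<exists>f. poly_time (encode (q_SAT q)) (encode (deletion_by_given_cvd \<Pi>)) f \<and>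
      (\<forall>\<phi>. is_q_cnf q \<phi> \<longrightarrow> f \<phi> \<in> instances (deletion_by_given_cvd \<Pi>) \<and>
        (yes_instance (deletion_by_given_cvd \<Pi>) (f \<phi>) \<longleftrightarrow> satisfiable \<phi>) \<and>
        parameter (deletion_by_given_cvd \<Pi>) (f \<phi>) = 2 * m * Suc (fst \<phi> div p))"
      using poly_time_reduction(2)
      by (intro exI[of _ ?f]) (simp add: q_SAT_def deletion_by_given_cvd_def)
  qed
qed

theorem theorem4p6:
  fixes \<epsilon> :: real
  assumes "SETH" and "\<epsilon> > 0"
  shows "\<not> solvable_in_Ostar FVS_by_CVD (\<lambda>k. (2 - \<epsilon>) ^ k) \<and>
         \<not> solvable_in_Ostar OCT_by_CVD (\<lambda>k. (2 - \<epsilon>) ^ k) \<and>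
         \<not> solvable_in_Ostar FVS_by_given_CVD (\<lambda>k. (2 - \<epsilon>) ^ k) \<and>
         \<not> solvable_in_Ostar OCT_by_given_CVD (\<lambda>k. (2 - \<epsilon>) ^ k)"
  unfolding FVS_by_CVD_def OCT_by_CVD_def FVS_by_given_CVD_def OCT_by_given_CVD_def
  using deletion_by_cvd_hard[where \<Pi> = forest, OF assms star_forest_forest forest_triangle_free]
    deletion_by_cvd_hard[where \<Pi> = bipartite, OF assms star_forest_bipartite bipartite_triangle_free]
  by blast

end
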